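(* Let $\mu$ be a strongly minimizing measure of a globally positive diffeomorphism $f$ of $\mathbb{A}_n=\mathbb{T}^n\times\mathbb{R}^n$ and let $\operatorname{supp}\mu$ be its support. Then for every $x\in\operatorname{supp}\mu$, the limit contingent cone $\widetilde C_x(\operatorname{supp}\mu)$ is between the modified Green bundles: $$\widetilde G_-(x)\le\widetilde C_x(\operatorname{supp}\mu)\le\widetilde G_+(x).$$
   Context: $\mathbb{A}_n=\mathbb{T}^n\times\mathbb{R}^n$ with $\mathbb{T}^n=\mathbb{R}^n/\mathbb{Z}^n$ has symplectic form $\omega=\sum_i dq_i\wedge dp_i$; $\pi(q,p)=q$; $V(x)=\ker D\pi(x)$; $T_x\mathbb{A}_n$ is identified with $\mathbb{R}^n\times\mathbb{R}^n$. Globally positive diffeomorphism: a symplectic $C^1$-diffeomorphism $f$ of $\mathbb{A}_n$ homotopic to the identity which has a lift $F$ to $\mathbb{R}^n\times\mathbb{R}^n$ admitting a $C^2$ generating function $S:\mathbb{R}^n\times\mathbb{R}^n\to\mathbb{R}$ such that (1) there is $\alpha>0$ with $\frac{\partial^2S}{\partial q\partial Q}(q,Q)(v,v)\le-\alpha\|v\|^2$ for all $q,Q,v$; (2) $F(q,p)=(Q,P)\iff p=-\frac{\partial S}{\partial q}(q,Q),\ P=\frac{\partial S}{\partial Q}(q,Q)$. Let $\bar L\in\mathbb{R}$ be the unique constant (Garibaldi–Thieullen) for which there exist $\mathbb{Z}^n$-periodic continuous $u_-,u_+:\mathbb{R}^n\to\mathbb{R}$ with $u_-(y)=\inf_x(u_-(x)+S(x,y)-\bar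 L)$ for all $y$ and $u_+(x)=\sup_y(u_+(y)-S(x,y)+\bar L)$ for all $x$. Put $\bar S=S-\bar L$ and $\bar{\mathcal F}(x_m,\dots,x_\ell)=\sum_{i=m+1}^{\ell}\bar S(x_{i-1},x_i)$. A configuration $(x_k)_{k\in\mathbb{Z}}$ of points of $\mathbb{R}^n$ is strongly minimizing if for all $m<\ell$, $m'<\ell'$ and every configuration $(y_k)_{k\in\mathbb{Z}}$ with $y_{m'}-x_m\in\mathbb{Z}^n$, $y_{\ell'}-x_\ell\in\mathbb{Z}^n$ one has $\bar{\mathcal F}(x_m,\dots,x_\ell)\le\bar{\mathcal F}(y_{m'},\dots,y_{\ell'})$; the corresponding orbit of $f$ is then called strongly minimizing. A strongly minimizing measure is an $f$-invariant Borel probability measure whose support is filled by strongly minimizing orbits. Green bundles: along such orbits, set $G_k(x)=Df^k\,V(f^{-k}x)$; the limits $G_\pm(x)=\lim_{k\to+\infty}G_{\pm k}(x)$ exist, are Lagrangian and transverse to $V(x)$ (known). Write $G_\pm(x)=\{(v,S_\pm(x)v):v\in\mathbb{R}^n\}$. With $c_0=\frac{\sqrt{13}}3-\frac56$, the modified Green bundles are $$\widetilde G_-(x)=\{(v,(S_-(x)-c_0(S_+(x)-S_-(x)))v):v\in\mathbb{R}^n\},\qquad \widetilde G_+(x)=\{(v,(S_+(x)+c_0(S_+(x)-S_-(x)))v):v\in\mathbb{R}^n\}.$$ Order: for Lagrangian subspaces $L_1,L_2$ of $T_x\mathbb{A}_n$ transverse to $V(x)$, $L_1\le L_2$ means that,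 writing $L_2$ as the graph of a linear map $\phi:L_1\to V(x)$, the quadratic form $v\mapsto\omega(v,\phi(v))$ on $L_1$ is positive semi-definite (equivalently, if $L_i$ is the graph of the symmetric matrix $A_i$, $A_2-A_1\ge0$). For $\mathcal L_-\le\mathcal L_+$, a vector $v$ is between $\mathcal L_-$ and $\mathcal L_+$ if there is a Lagrangian subspace $\mathcal L\ni v$, with $\mathcal L_-\le\mathcal L\le\mathcal L_+$; a set $B$ of vectors is between $\mathcal L_-$ and $\mathcal L_+$, written $\mathcal L_-\le B\le\mathcal L_+$, if each of its elements is. Cones: for $A\subset\mathbb{R}^n\times\mathbb{R}^n$ and $a\in A$, the contingent cone $C_aA$ is the set of all limit points of sequences $t_k(a_k-a)$ with $t_k\in\mathbb{R}$, $a_k\in A$, $a_k\to a$. The limit contingent cone $\widetilde C_aA$ is the set of limit points of sequences $v_k\in C_{a_k}A$, where $(a_k)$ is any sequence of points of $A$ converging to $a$. For subsets of $\mathbb{A}_n$ these are computed in the universal cover $\mathbb{R}^n\times\mathbb{R}^n$. *)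

theory Defs
  imports "HOL-Analysis.Analysis" "HOL-Probability.Probability_Measure"
begin

definition int_vecs :: "(real ^ 'n) set" where
  "int_vecs = {k. \<forall>i. k $ i \<in> \<int>}"

quotient_type (overloaded) 'n torus = "real ^ ('n::finite)" / "\<lambda>x y. x - y \<in> int_vecs"
proof (rule equivpI)
  show "reflp (\<lambda>x y :: real ^ 'n. x - y \<in> int_vecs)"
    by (rule reflpI) (simp add: int_vecs_def)
  show "symp (\<lambda>x y :: real ^ 'n. x - y \<in> int_vecs)"
  proof (rule sympI)
    fix x y :: "real ^ 'n"
    assume "x - y \<in> int_vecs"
    then have "- (x $ i - y $ i) \<in> \<int>" for i
      unfolding int_vecs_def by (intro Ints_minus) simp
    then show "y - x \<in> int_vecs" by (simp add: int_vecs_def)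
  qed
  show "transp (\<lambda>x y :: real ^ 'n. x - y \<in> int_vecs)"
  proof (rule transpI)
    fix x y z :: "real ^ 'n"
    assume "x - y \<in> int_vecs" "y - z \<in> int_vecs"
    then have "(x $ i - y $ i) + (y $ i - z $ i) \<in> \<int>" for i
      unfolding int_vecs_def by (intro Ints_add) simp_all
    then show "x - z \<in> int_vecs" by (simp add: int_vecs_def)
  qed
qed

instantiation torus :: (finite) topological_space
begin

definition open_torus :: "'a torus set \<Rightarrow> bool" where
  "open_torus U \<longleftrightarrow> open (abs_torus -` U)"

instance
  by standard (auto simp: open_torus_def vimage_Union)

end

type_synonym 'n annulus = "'n torus \<times> (real ^ 'n)"
type_synonym 'n plane = "(real ^ 'n) \<times> (real ^ 'n)"

definition cover :: "'n::finite plane \<Rightarrow> 'n annulus" where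
  "cover z = (abs_torus (fst z), snd z)"

text \<open>\<open>plane\<close> is used both as the universal cover and as the tangent space at any of its points
  (equivalently, at any point of the annulus).\<close>

definition omega :: "'n::finite plane \<Rightarrow> 'n plane \<Rightarrow> real" where
  "omega u v = fst u \<bullet> snd v - snd u \<bullet> fst v"

definition vertical :: "'n::finite plane set" where
  "vertical = {v. fst v = 0}"

definition lagrangian :: "'n::finite plane set \<Rightarrow> bool" where
  "lagrangian L \<longleftrightarrow> subspace L \<and> dim L = CARD('n) \<and> (\<forall>u\<in>L. \<forall>v\<in>L. omega u v = 0)"

definition transverse_lagrangian :: "'n::finite plane set \<Rightarrow> bool" where
  "transverse_lagrangian L \<longleftrightarrow> lagrangian L \<and> L \<inter> vertical = {0}"

text \<open>Only the restriction of \<open>\<phi>\<close> to \<open>L1\<close> matters; every linear map on \<open>L1\<close> extends to the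
  whole space.\<close>

definition lag_le :: "'n::finite plane set \<Rightarrow> 'n plane set \<Rightarrow> bool" where
  "lag_le L1 L2 \<longleftrightarrow> transverse_lagrangian L1 \<and> transverse_lagrangian L2 \<and>
     (\<exists>\<phi>. linear \<phi> \<and> \<phi> ` L1 \<subseteq> vertical \<and> L2 = {v + \<phi> v |v. v \<in> L1} \<and>
          (\<forall>v\<in>L1. 0 \<le> omega v (\<phi> v)))"

definition vector_between :: "'n::finite plane set \<Rightarrow> 'n plane \<Rightarrow> 'n plane set \<Rightarrow> bool" where
  "vector_between L1 v L2 \<longleftrightarrow> (\<exists>L. lagrangian L \<and> v \<in> L \<and> lag_le L1 L \<and> lag_le L L2)"

definition set_between :: "'n::finite plane set \<Rightarrow> 'n plane set \<Rightarrow> 'n plane set \<Rightarrow> bool" where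
  "set_between L1 B L2 \<longleftrightarrow> lag_le L1 L2 \<and> (\<forall>v\<in>B. vector_between L1 v L2)"

definition matrix_graph :: "real ^ 'n ^ 'n \<Rightarrow> 'n::finite plane set" where
  "matrix_graph A = {(v, A *v v) |v. True}"

definition C1_map :: "('a::real_normed_vector \<Rightarrow> 'b::real_normed_vector) \<Rightarrow> bool" where
  "C1_map g \<longleftrightarrow> (\<exists>g' :: 'a \<Rightarrow> 'a \<Rightarrow>\<^sub>L 'b.
     (\<forall>x. (g has_derivative blinfun_apply (g' x)) (at x)) \<and> continuous_on UNIV g')"

definition C2_map :: "('a::real_normed_vector \<Rightarrow> 'b::real_normed_vector) \<Rightarrow> bool" where
  "C2_map g \<longleftrightarrow> (\<exists>g' :: 'a \<Rightarrow> 'a \<Rightarrow>\<^sub>L 'b.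
     (\<forall>x. (g has_derivative blinfun_apply (g' x)) (at x)) \<and> C1_map g')"

text \<open>A map of the annulus is \<open>C\<^sup>1\<close> iff it has a \<open>C\<^sup>1\<close> lift: the universal cover is simply
  connected and \<open>cover\<close> is a local diffeomorphism. Any two lifts differ by a constant integer
  translation, so they have the same derivatives.\<close>

definition C1_lift :: "('n::finite annulus \<Rightarrow> 'n annulus) \<Rightarrow> ('n plane \<Rightarrow> 'n plane) \<Rightarrow> bool" where
  "C1_lift f F \<longleftrightarrow> C1_map F \<and> (\<forall>z. cover (F z) = f (cover z))"

definition C1_diffeo :: "('n::finite annulus \<Rightarrow> 'n annulus) \<Rightarrow> bool" where
  "C1_diffeo f \<longleftrightarrow> bij f \<and> (\<exists>F. C1_lift f F) \<and> (\<exists>G. C1_lift (inv f) G)"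

definition symplectic_map :: "('n::finite plane \<Rightarrow> 'n plane) \<Rightarrow> bool" where
  "symplectic_map F \<longleftrightarrow>
     (\<forall>z u v. omega (frechet_derivative F (at z) u) (frechet_derivative F (at z) v) = omega u v)"

definition grad_q :: "('n::finite plane \<Rightarrow> real) \<Rightarrow> real ^ 'n \<Rightarrow> real ^ 'n \<Rightarrow> real ^ 'n" where
  "grad_q S q Q = (\<chi> i. frechet_derivative (\<lambda>q'. S (q', Q)) (at q) (axis i 1))"

definition grad_Q :: "('n::finite plane \<Rightarrow> real) \<Rightarrow> real ^ 'n \<Rightarrow> real ^ 'n \<Rightarrow> real ^ 'n" where
  "grad_Q S q Q = (\<chi> i. frechet_derivative (\<lambda>Q'. S (q, Q')) (at Q) (axis i 1))"

definition mixed_hessian ::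
    "('n::finite plane \<Rightarrow> real) \<Rightarrow> real ^ 'n \<Rightarrow> real ^ 'n \<Rightarrow> real ^ 'n \<Rightarrow> real ^ 'n \<Rightarrow> real" where
  "mixed_hessian S q Q v w = frechet_derivative (\<lambda>Q'. grad_q S q Q' \<bullet> v) (at Q) w"

definition generating_function :: "('n::finite plane \<Rightarrow> 'n plane) \<Rightarrow> ('n plane \<Rightarrow> real) \<Rightarrow> bool" where
  "generating_function F S \<longleftrightarrow> C2_map S \<and>
     (\<exists>\<alpha>>0. \<forall>q Q v. mixed_hessian S q Q v v \<le> - \<alpha> * (norm v)\<^sup>2) \<and>
     (\<forall>q p Q P. F (q, p) = (Q, P) \<longleftrightarrow> p = - grad_q S q Q \<and> P = grad_Q S q Q)"

text \<open>\<open>f\<close> is a globally positive diffeomorphism, as witnessed by the lift \<open>F\<close> and the generating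
  function \<open>S\<close>.\<close>

definition globally_positive ::
    "('n::finite annulus \<Rightarrow> 'n annulus) \<Rightarrow> ('n plane \<Rightarrow> 'n plane) \<Rightarrow> ('n plane \<Rightarrow> real) \<Rightarrow> bool" where
  "globally_positive f F S \<longleftrightarrow>
     C1_diffeo f \<and> homotopic_with_canon (\<lambda>_. True) UNIV UNIV f id \<and>
     C1_lift f F \<and> symplectic_map F \<and> generating_function F S"

definition int_periodic :: "(real ^ 'n::finite \<Rightarrow> real) \<Rightarrow> bool" where
  "int_periodic u \<longleftrightarrow> (\<forall>x. \<forall>k\<in>int_vecs. u (x + k) = u x)"

text \<open>The boundedness clauses make the real-valued \<open>INF\<close> and \<open>SUP\<close> meaningful.\<close>

definition critical_constant :: "('n::finite plane \<Rightarrow> real) \<Rightarrow> real \<Rightarrow> bool" where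
  "critical_constant S c \<longleftrightarrow>
     (\<exists>u v. continuous_on UNIV u \<and> int_periodic u \<and> continuous_on UNIV v \<and> int_periodic v \<and>
       (\<forall>y. bdd_below (range (\<lambda>x. u x + S (x, y) - c)) \<and> u y = (INF x. (u x + S (x, y) - c))) \<and>
       (\<forall>x. bdd_above (range (\<lambda>y. v y - S (x, y) + c)) \<and> v x = (SUP y. (v y - S (x, y) + c))))"

definition action ::
    "('n::finite plane \<Rightarrow> real) \<Rightarrow> real \<Rightarrow> (int \<Rightarrow> real ^ 'n) \<Rightarrow> int \<Rightarrow> int \<Rightarrow> real" where
  "action S c x m l = (\<Sum>i=m+1..l. (S (x (i - 1), x i) - c))"

definition strongly_minimizing ::
    "('n::finite plane \<Rightarrow> real) \<Rightarrow> real \<Rightarrow> (int \<Rightarrow> real ^ 'n) \<Rightarrow> bool" where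
  "strongly_minimizing S c x \<longleftrightarrow>
     (\<forall>m l m' l' y. m < l \<longrightarrow> m' < l' \<longrightarrow> y m' - x m \<in> int_vecs \<longrightarrow> y l' - x l \<in> int_vecs \<longrightarrow>
        action S c x m l \<le> action S c y m' l')"

definition int_iter :: "('a \<Rightarrow> 'a) \<Rightarrow> int \<Rightarrow> 'a \<Rightarrow> 'a" where
  "int_iter F k = (if 0 \<le> k then F ^^ nat k else inv F ^^ nat (- k))"

definition support :: "'a::topological_space measure \<Rightarrow> 'a set" where
  "support M = {x. \<forall>U. open U \<longrightarrow> x \<in> U \<longrightarrow> 0 < emeasure M U}"

definition strongly_minimizing_measure ::
    "('n::finite annulus \<Rightarrow> 'n annulus) \<Rightarrow> ('n plane \<Rightarrow> 'n plane) \<Rightarrow> ('n plane \<Rightarrow> real) \<Rightarrow> real \<Rightarrow>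
     'n annulus measure \<Rightarrow> bool" where
  "strongly_minimizing_measure f F S c \<mu> \<longleftrightarrow>
     sets \<mu> = sets borel \<and> prob_space \<mu> \<and> distr \<mu> borel f = \<mu> \<and>
     (\<forall>z. cover z \<in> support \<mu> \<longrightarrow> strongly_minimizing S c (\<lambda>k. fst (int_iter F k z)))"

definition green_iterate :: "('n::finite plane \<Rightarrow> 'n plane) \<Rightarrow> int \<Rightarrow> 'n plane \<Rightarrow> 'n plane set" where
  "green_iterate F k z = frechet_derivative (int_iter F k) (at (int_iter F (- k) z)) ` vertical"

text \<open>Convergence in the Grassmannian, metrized by the operator norm of the difference of
  orthogonal projections (on a subspace, \<open>closest_point\<close> is the orthogonal projection).\<close>

definition subspace_limit :: "(nat \<Rightarrow> 'a::euclidean_space set) \<Rightarrow> 'a set \<Rightarrow> bool" where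
  "subspace_limit G L \<longleftrightarrow> subspace L \<and>
     (\<lambda>k. onorm (\<lambda>v. closest_point (G k) v - closest_point L v)) \<longlonglongrightarrow> 0"

definition green_minus :: "('n::finite plane \<Rightarrow> 'n plane) \<Rightarrow> 'n plane \<Rightarrow> 'n plane set" where
  "green_minus F z = (THE L. subspace_limit (\<lambda>k. green_iterate F (- int k) z) L)"

definition green_plus :: "('n::finite plane \<Rightarrow> 'n plane) \<Rightarrow> 'n plane \<Rightarrow> 'n plane set" where
  "green_plus F z = (THE L. subspace_limit (\<lambda>k. green_iterate F (int k) z) L)"

definition slope_minus :: "('n::finite plane \<Rightarrow> 'n plane) \<Rightarrow> 'n plane \<Rightarrow> real ^ 'n ^ 'n" where
  "slope_minus F z = (THE A. green_minus F z = matrix_graph A)"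

definition slope_plus :: "('n::finite plane \<Rightarrow> 'n plane) \<Rightarrow> 'n plane \<Rightarrow> real ^ 'n ^ 'n" where
  "slope_plus F z = (THE A. green_plus F z = matrix_graph A)"

definition c0 :: real where
  "c0 = sqrt 13 / 3 - 5 / 6"

definition modified_green_minus :: "('n::finite plane \<Rightarrow> 'n plane) \<Rightarrow> 'n plane \<Rightarrow> 'n plane set" where
  "modified_green_minus F z =
     matrix_graph (slope_minus F z - c0 *\<^sub>R (slope_plus F z - slope_minus F z))"

definition modified_green_plus :: "('n::finite plane \<Rightarrow> 'n plane) \<Rightarrow> 'n plane \<Rightarrow> 'n plane set" where
  "modified_green_plus F z =
     matrix_graph (slope_plus F z + c0 *\<^sub>R (slope_plus F z - slope_minus F z))"

definition limit_points :: "(nat \<Rightarrow> 'a::topological_space) \<Rightarrow> 'a set" where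
  "limit_points s = {v. \<exists>r. strict_mono r \<and> (s \<circ> r) \<longlonglongrightarrow> v}"

definition contingent_cone :: "'a::real_normed_vector set \<Rightarrow> 'a \<Rightarrow> 'a set" where
  "contingent_cone A a =
     {v. \<exists>(t :: nat \<Rightarrow> real) s. (\<forall>k. s k \<in> A) \<and> s \<longlonglongrightarrow> a \<and> v \<in> limit_points (\<lambda>k. t k *\<^sub>R (s k - a))}"

definition limit_contingent_cone :: "'a::real_normed_vector set \<Rightarrow> 'a \<Rightarrow> 'a set" where
  "limit_contingent_cone A a =
     {v. \<exists>s w. (\<forall>k. s k \<in> A) \<and> s \<longlonglongrightarrow> a \<and> (\<forall>k. w k \<in> contingent_cone A (s k)) \<and> v \<in> limit_points w}"

end

theory Submission
  imports Defs
begin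

text \<open>
  The theorem rests on a weak KAM solution \<open>u\<close>, a periodic function that satisfies
  \<open>u Q \<le> u q + S (q, Q) - Lbar\<close> for all \<open>q\<close> and \<open>Q\<close>. The definition of \<open>Lbar\<close> provides one.

  Along the orbits in the support of the measure this inequality is an equality
  (\<open>calibrated_on_support\<close>). Indeed, the sum of the defects \<open>u q + S (q, Q) - Lbar - u Q\<close> over any
  segment of such an orbit is bounded independently of the length of the segment, because the action
  of a strongly minimizing segment does not exceed that of a single step between its ends modulo
  integer translations. Integrating over the invariant measure shows that the mean of the defect is
  zero.

  Now fix a point \<open>z\<close> over the support and a length \<open>k\<close>. Comparing \<open>u\<close> near the projection of the
  orbit with the action of varied paths that leave the orbit \<open>k\<close> steps in the past bounds \<open>u\<close> from
  above by a quadratic function; if the variation is a tangent orbit starting in the vertical, the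
  Hessian of this function is the slope of \<open>green_iterate F k z\<close> (\<open>upper_green\<close>). Paths that return
  to the orbit \<open>k\<close> steps in the future similarly bound \<open>u\<close> from below, with the slope of
  \<open>green_iterate F (- k) z\<close>. These bounds are uniform over base points of the support near \<open>z\<close>. They
  also yield the existence of the Green bundles: the upper slopes are finite (\<open>green_vertical\<close>),
  decrease with \<open>k\<close> (\<open>green_mono\<close>), and stay above the lower ones. Write \<open>P\<close> and \<open>N\<close> for the limits
  of the upper and lower slopes.

  Consider finally two points of the support close to \<open>z\<close> whose difference is, up to scaling, close
  to \<open>(v, w)\<close>. A quadratic lower bound based at one of them lies below a quadratic upper bound based
  at the other, at every point near both. Using this at two symmetric points eliminates the unknown
  difference of the values of \<open>u\<close> and gives, for all \<open>\<eta>\<close>,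
  \<open>- (w \<bullet> (2 *\<^sub>R \<eta> + v)) \<le> \<eta> \<bullet> (P *v \<eta>) - (\<eta> + v) \<bullet> (N *v (\<eta> + v))\<close> (\<open>pair_inequality\<close>). It applies
  to every \<open>(v, w)\<close> in the limit contingent cone, since such vectors are limits of secants. With
  \<open>M = (N + P) / 2\<close> and \<open>D = P - N\<close>, the choice \<open>\<eta> = g - v / 2\<close> and a scaling of \<open>g\<close> turn the
  inequality into \<open>(r \<bullet> g)\<^sup>2 \<le> (v \<bullet> (D *v v)) * (g \<bullet> (D *v g)) / 4\<close> for \<open>r = w - M *v v\<close>. This is
  enough for an explicit symmetric matrix that maps \<open>v\<close> to \<open>r\<close> and lies between
  \<open>- (1 / 2 + c0) *\<^sub>R D\<close> and \<open>(1 / 2 + c0) *\<^sub>R D\<close> (\<open>symmetric_interpolation\<close>). Adding \<open>M\<close> to it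
  gives the slope of a Lagrangian subspace that contains \<open>(v, w)\<close> and lies between the modified
  Green bundles.
\<close>

section \<open>Symmetric matrices and their Lagrangian graphs\<close>

lemma symmetric_inner: "transpose A = A \<Longrightarrow> x \<bullet> (A *v y) = (A *v x) \<bullet> (y :: real ^ 'n)"
  by (metis dot_lmul_matrix transpose_matrix_vector)

lemma matrix_graph_inject: "matrix_graph A = matrix_graph B \<longleftrightarrow> A = (B :: real ^ 'n::finite ^ 'n)"
proof
  assume "matrix_graph A = matrix_graph B"
  moreover have "(v, A *v v) \<in> matrix_graph A" for v by (auto simp: matrix_graph_def)
  ultimately have "A *v v = B *v v" for v by (auto simp: matrix_graph_def)
  then show "A = B" by (simp add: matrix_eq)
qed simp

lemma matrix_graph_image: "matrix_graph A = (\<lambda>v. (v, A *v v)) ` UNIV"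
  by (auto simp: matrix_graph_def)

lemma linear_graph_map: "linear (\<lambda>v. (v, A *v v :: real ^ 'n::finite))"
  by (auto simp: linear_iff matrix_vector_right_distrib matrix_vector_mult_scaleR)

lemma subspace_matrix_graph: "subspace (matrix_graph A)"
  unfolding matrix_graph_image by (rule linear_subspace_image[OF linear_graph_map]) simp

lemma transverse_lagrangian_matrix_graph:
  fixes A :: "real ^ 'n::finite ^ 'n"
  assumes "transpose A = A"
  shows "transverse_lagrangian (matrix_graph A)"
proof -
  have "dim (matrix_graph A) = CARD('n)"
    unfolding matrix_graph_image
    by (subst dim_image_eq[OF linear_graph_map]) (auto intro: injI simp: dim_UNIV)
  moreover have "omega x y = 0" if "x \<in> matrix_graph A" "y \<in> matrix_graph A" for x y
    using that symmetric_inner[OF assms] by (auto simp: matrix_graph_def omega_def)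
  ultimately show ?thesis
    using subspace_matrix_graph[of A]
    by (auto simp: transverse_lagrangian_def lagrangian_def matrix_graph_def vertical_def zero_prod_def)
qed

lemma lag_le_matrix_graph:
  fixes A B :: "real ^ 'n::finite ^ 'n"
  assumes "transpose A = A" "transpose B = B" "\<And>h. h \<bullet> (A *v h) \<le> h \<bullet> (B *v h)"
  shows "lag_le (matrix_graph A) (matrix_graph B)"
proof -
  define \<phi> where "\<phi> v = (0 :: real ^ 'n, (B - A) *v fst v)" for v :: "'n plane"
  have "linear \<phi>"
    by (auto simp: linear_iff \<phi>_def matrix_vector_right_distrib matrix_vector_mult_scaleR)
  moreover have "\<phi> ` matrix_graph A \<subseteq> vertical" by (auto simp: \<phi>_def vertical_def)
  moreover have "matrix_graph B = {v + \<phi> v |v. v \<in> matrix_graph A}"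
    by (auto simp: \<phi>_def matrix_graph_def matrix_vector_mult_diff_rdistrib)
  moreover have "\<forall>v\<in>matrix_graph A. 0 \<le> omega v (\<phi> v)"
    using assms(3) by (auto simp: \<phi>_def matrix_graph_def omega_def matrix_vector_mult_diff_rdistrib inner_diff_right)
  ultimately show ?thesis
    unfolding lag_le_def using transverse_lagrangian_matrix_graph assms by blast
qed

lemma quadratic_nonneg_discriminant:
  fixes a b c :: real
  assumes "0 \<le> a" "\<And>t. 0 \<le> a * t\<^sup>2 + 2 * b * t + c"
  shows "b\<^sup>2 \<le> a * c"
proof (cases "a = 0")
  case True
  have "b = 0"
  proof (rule ccontr)
    assume "b \<noteq> 0"
    with assms(2)[of "- (c + 1) / (2 * b)"] True show False by simp
  qed
  then show ?thesis using True by simp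
next
  case False
  then have a: "a > 0" using assms(1) by simp
  have "0 \<le> a * (a * (- b / a)\<^sup>2 + 2 * b * (- b / a) + c)"
    using a assms(2)[of "- b / a"] by (intro mult_nonneg_nonneg) auto
  also have "\<dots> = a * c - b\<^sup>2" using a by (simp add: field_simps power2_eq_square)
  finally show ?thesis by simp
qed

text \<open>
  The quadratic form on the left has as its largest eigenvalue half the golden ratio, about \<open>0.809\<close>,
  whereas \<open>1 / 2 + c0\<close> is about \<open>0.868\<close>; the proof separates the two by \<open>13 / 15\<close>.
\<close>

lemma half_plus_c0_bound:
  fixes x y :: real
  shows "x\<^sup>2 / 2 + \<bar>x\<bar> * y \<le> (1 / 2 + c0) * (x\<^sup>2 + y\<^sup>2)"
proof -
  have "(36 / 10)\<^sup>2 \<le> (13 :: real)" by (simp add: power2_eq_square)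
  then have "36 / 10 \<le> sqrt 13" by (rule real_le_rsqrt)
  then have k: "13 / 15 \<le> 1 / 2 + c0" by (simp add: c0_def)
  have "0 \<le> (\<bar>x\<bar> * (11 / 30) - y / 2)\<^sup>2 + y\<^sup>2 * (13/15 * 11/30 - 1/4)"
    by (intro add_nonneg_nonneg mult_nonneg_nonneg) auto
  then have "x\<^sup>2 / 2 + \<bar>x\<bar> * y \<le> 13 / 15 * (x\<^sup>2 + y\<^sup>2)"
    by (simp add: power2_eq_square algebra_simps)
  also have "\<dots> \<le> (1 / 2 + c0) * (x\<^sup>2 + y\<^sup>2)" using k by (intro mult_right_mono) auto
  finally show ?thesis .
qed

lemma c0_nonneg: "0 \<le> c0"
  using half_plus_c0_bound[of 1 0] by (simp add: algebra_simps)

text \<open>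
  Replacing \<open>g\<close> by its multiples turns the hypothesis on \<open>r\<close> into the Cauchy--Schwarz type estimate
  \<open>(r \<bullet> g)\<^sup>2 \<le> q v * q g / 4\<close> for \<open>q h = h \<bullet> (D *v h)\<close>. The matrix \<open>N\<close> is the symmetric one with
  \<open>N *v v = r\<close> whose form vanishes on the \<open>D\<close>-orthogonal complement of \<open>v\<close>. In a \<open>D\<close>-orthonormal
  frame that begins in the direction of \<open>v\<close> it has a single nonzero row and column, of length at
  most \<open>1 / 2\<close>, so its norm is governed by the two-dimensional estimate \<open>half_plus_c0_bound\<close>. A
  degenerate \<open>D\<close> causes no trouble, because \<open>r\<close> annihilates the kernel of \<open>D\<close>.
\<close>

lemma symmetric_interpolation:
  fixes D :: "real ^ 'n ^ 'n"
  assumes D: "transpose D = D" and pos: "\<And>h. 0 \<le> h \<bullet> (D *v h)"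
    and r: "\<And>g. \<bar>r \<bullet> g\<bar> \<le> (g \<bullet> (D *v g)) / 2 + (v \<bullet> (D *v v)) / 8"
  shows "\<exists>N. transpose N = N \<and> N *v v = r \<and> (\<forall>h. \<bar>h \<bullet> (N *v h)\<bar> \<le> (1 / 2 + c0) * (h \<bullet> (D *v h)))"
proof -
  define q where "q h = h \<bullet> (D *v h)" for h
  define \<rho> where "\<rho> = q v"
  have q0: "q h \<ge> 0" for h using pos by (simp add: q_def)
  have qs: "q (t *\<^sub>R h) = t\<^sup>2 * q h" for t h
    by (simp add: q_def matrix_vector_mult_scaleR power2_eq_square)
  have rq: "(r \<bullet> g)\<^sup>2 \<le> \<rho> * q g / 4" for g
  proof -
    have "0 \<le> (q g / 2) * t\<^sup>2 + 2 * (- (r \<bullet> g) / 2) * t + \<rho> / 8" for t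
      using r[of "t *\<^sub>R g"] qs[of t g] by (simp add: q_def \<rho>_def abs_le_iff power2_eq_square algebra_simps)
    from quadratic_nonneg_discriminant[OF _ this] show ?thesis using q0[of g] by (simp add: power_divide algebra_simps)
  qed
  show ?thesis
  proof (cases "\<rho> = 0")
    case True
    then have "r \<bullet> r = 0" using rq[of r] by simp
    then show ?thesis using q0 c0_nonneg by (intro exI[of _ 0]) (auto simp: q_def transpose_def vec_eq_iff)
  next
    case False
    then have \<rho>: "\<rho> > 0" using q0[of v] by (simp add: \<rho>_def)
    define a where "a = D *v v"
    have av: "a \<bullet> v = \<rho>" by (simp add: a_def \<rho>_def q_def inner_commute)
    define \<beta> where "\<beta> = (r \<bullet> v) / \<rho>"
    define Nf where "Nf h = ((a \<bullet> h) / \<rho>) *\<^sub>R r + ((r \<bullet> h) / \<rho> - \<beta> * (a \<bullet> h) / \<rho>) *\<^sub>R a" for h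
    have lin: "linear Nf"
      by (auto simp: linear_iff Nf_def inner_add_right algebra_simps add_divide_distrib)
    define N where "N = matrix Nf"
    have N: "N *v h = Nf h" for h
      unfolding N_def by (rule matrix_works) (simp add: linear_matrix_vector_mul_eq lin)
    have "h \<bullet> (N *v k) = (N *v h) \<bullet> k" for h k
      by (simp add: N Nf_def inner_add_left inner_add_right inner_commute algebra_simps)
    then have tr: "transpose N = N"
      by (metis dot_lmul_matrix inner_commute matrix_eq vector_eq_ldot transpose_matrix_vector)
    have Nv: "N *v v = r" using \<rho> by (simp add: N Nf_def av \<beta>_def)
    have "\<bar>h \<bullet> (N *v h)\<bar> \<le> (1 / 2 + c0) * q h" for h
    proof -
      define s where "s = (a \<bullet> h) / \<rho>"
      define g where "g = h - s *\<^sub>R v"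
      have ag: "a \<bullet> g = 0" using \<rho> by (simp add: g_def inner_diff_right av s_def)
      have qh: "q h = s\<^sup>2 * \<rho> + q g"
      proof -
        have h: "h = s *\<^sub>R v + g" by (simp add: g_def)
        have "v \<bullet> (D *v g) = 0" "g \<bullet> (D *v v) = 0"
          using ag symmetric_inner[OF D, of v g] by (simp_all add: a_def inner_commute)
        then show ?thesis
          by (subst h) (simp add: q_def \<rho>_def matrix_vector_right_distrib matrix_vector_mult_scaleR
            inner_add_left inner_add_right power2_eq_square)
      qed
      have ah: "a \<bullet> h = s * \<rho>" using \<rho> by (simp add: s_def)
      have rh: "r \<bullet> h = s * (\<beta> * \<rho>) + r \<bullet> g"
        using \<rho> by (simp add: g_def inner_diff_right \<beta>_def)
      have "h \<bullet> (N *v h) = s * (r \<bullet> h) + ((r \<bullet> h) / \<rho> - \<beta> * s) * (s * \<rho>)"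
        using \<rho> by (simp add: N Nf_def inner_add_right ah inner_commute[of h])
      also have "\<dots> = \<beta> * (s\<^sup>2 * \<rho>) + 2 * s * (r \<bullet> g)"
        unfolding rh using \<rho> by (simp add: field_simps power2_eq_square)
      finally have hN: "h \<bullet> (N *v h) = \<beta> * (s\<^sup>2 * \<rho>) + 2 * s * (r \<bullet> g)" .
      define x where "x = s * sqrt \<rho>"
      define y where "y = sqrt (q g)"
      have x2: "x\<^sup>2 = s\<^sup>2 * \<rho>" and y2: "y\<^sup>2 = q g"
        using \<rho> q0 by (simp_all add: x_def y_def power_mult_distrib)
      have "\<bar>\<beta>\<bar> \<le> 1 / 2"
      proof -
        have "\<beta>\<^sup>2 * \<rho>\<^sup>2 \<le> 1 / 4 * \<rho>\<^sup>2" using rq[of v] \<rho>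
          by (simp add: \<beta>_def power_divide flip: \<rho>_def) (simp add: power2_eq_square)
        then have "\<beta>\<^sup>2 \<le> (1 / 2)\<^sup>2" using \<rho> by (simp add: power2_eq_square)
        then show ?thesis using abs_le_square_iff[of \<beta> "1 / 2"] by simp
      qed
      then have 1: "\<bar>\<beta> * (s\<^sup>2 * \<rho>)\<bar> \<le> 1 / 2 * x\<^sup>2"
        unfolding x2 abs_mult using \<rho> by (intro mult_mono) auto
      have "\<bar>r \<bullet> g\<bar> \<le> sqrt \<rho> * y / 2"
      proof -
        have "\<bar>r \<bullet> g\<bar> = sqrt ((r \<bullet> g)\<^sup>2)" by simp
        also have "\<dots> \<le> sqrt (\<rho> * q g / 4)" using rq by (rule real_sqrt_le_mono)
        also have "\<dots> = sqrt \<rho> * y / 2" by (simp add: real_sqrt_mult real_sqrt_divide y_def)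
        finally show ?thesis .
      qed
      then have "2 * \<bar>s\<bar> * \<bar>r \<bullet> g\<bar> \<le> 2 * \<bar>s\<bar> * (sqrt \<rho> * y / 2)" by (intro mult_left_mono) auto
      then have 2: "\<bar>2 * s * (r \<bullet> g)\<bar> \<le> \<bar>x\<bar> * y" using \<rho> by (simp add: x_def abs_mult)
      have "\<bar>h \<bullet> (N *v h)\<bar> \<le> x\<^sup>2 / 2 + \<bar>x\<bar> * y" unfolding hN using 1 2 by linarith
      also have "\<dots> \<le> (1 / 2 + c0) * (x\<^sup>2 + y\<^sup>2)" by (rule half_plus_c0_bound)
      finally show ?thesis by (simp add: x2 y2 qh)
    qed
    then show ?thesis using tr Nv by (auto simp: q_def)
  qed
qed

text \<open>
  Centre the problem at the mean \<open>M\<close> of \<open>N\<close> and \<open>P\<close>: with \<open>\<eta> = g - v / 2\<close> the two quadratic forms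
  are evaluated at \<open>g - v / 2\<close> and \<open>g + v / 2\<close>, the contributions of \<open>M\<close> collapse to
  \<open>- 2 * (g \<bullet> (M *v v))\<close>, and what is left is the hypothesis of \<open>symmetric_interpolation\<close> for the
  gap \<open>D = P - N\<close> and the residual slope \<open>r = w - M *v v\<close>. The Lagrangian subspace through \<open>(v, w)\<close>
  is then the graph of \<open>M\<close> plus the interpolating matrix.
\<close>

lemma between_modified:
  fixes P N :: "real ^ 'n::finite ^ 'n"
  assumes P: "transpose P = P" and N: "transpose N = N"
    and le: "\<And>h. h \<bullet> (N *v h) \<le> h \<bullet> (P *v h)"
    and pair: "\<And>\<eta>. - (w \<bullet> (2 *\<^sub>R \<eta> + v)) \<le> \<eta> \<bullet> (P *v \<eta>) - (\<eta> + v) \<bullet> (N *v (\<eta> + v))"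
  shows "vector_between (matrix_graph (N - c0 *\<^sub>R (P - N))) (v, w) (matrix_graph (P + c0 *\<^sub>R (P - N)))"
proof -
  define M where "M = (1 / 2) *\<^sub>R (P + N)"
  define D where "D = P - N"
  define r where "r = w - M *v v"
  have mvs: "(c *\<^sub>R A) *v h = c *\<^sub>R (A *v h)" for c and A :: "real ^ 'n ^ 'n" and h
    by (simp add: scaleR_matrix_vector_assoc)
  have tM: "transpose M = M" and tD: "transpose D = D"
    using P N by (simp_all add: M_def D_def transpose_def vec_eq_iff)
  have Pe: "P *v h = M *v h + (1 / 2) *\<^sub>R (D *v h)" and Ne: "N *v h = M *v h - (1 / 2) *\<^sub>R (D *v h)" for h
    by (simp_all add: M_def D_def mvs matrix_vector_mult_add_rdistrib matrix_vector_mult_diff_rdistrib vec_eq_iff)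
       (simp_all add: field_simps)
  have pos: "0 \<le> h \<bullet> (D *v h)" for h
    using le[of h] by (simp add: D_def matrix_vector_mult_diff_rdistrib inner_diff_right)
  have one: "- (r \<bullet> g) \<le> (g \<bullet> (D *v g)) / 2 + (v \<bullet> (D *v v)) / 8" for g
  proof -
    define \<eta> where "\<eta> = g - (1 / 2) *\<^sub>R v"
    have 1: "2 *\<^sub>R \<eta> + v = 2 *\<^sub>R g" "\<eta> + v = g + (1 / 2) *\<^sub>R v"
      by (simp_all add: \<eta>_def vec_eq_iff field_simps)
    have s: "v \<bullet> (M *v g) = g \<bullet> (M *v v)" "v \<bullet> (D *v g) = g \<bullet> (D *v v)"
      using symmetric_inner[OF tM, of v g] symmetric_inner[OF tD, of v g] by (simp_all add: inner_commute)
    have "- (2 * (w \<bullet> g)) \<le> \<eta> \<bullet> (P *v \<eta>) - (g + (1 / 2) *\<^sub>R v) \<bullet> (N *v (g + (1 / 2) *\<^sub>R v))"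
      using pair[of \<eta>] unfolding 1 by simp
    also have "\<dots> = - 2 * (g \<bullet> (M *v v)) + g \<bullet> (D *v g) + (v \<bullet> (D *v v)) / 4"
      unfolding \<eta>_def Pe Ne
      by (simp add: matrix_vector_right_distrib matrix_vector_mult_diff_distrib matrix_vector_mult_scaleR
          inner_add_left inner_add_right inner_diff_left inner_diff_right s algebra_simps)
    finally show ?thesis by (simp add: r_def inner_diff_left inner_diff_right inner_commute)
  qed
  have "\<bar>r \<bullet> g\<bar> \<le> (g \<bullet> (D *v g)) / 2 + (v \<bullet> (D *v v)) / 8" for g
    using one[of g] one[of "- g"] by (simp add: abs_le_iff linear_neg[OF matrix_vector_mul_linear])
  from symmetric_interpolation[OF tD pos this] obtain K where
    K: "transpose K = K" "K *v v = r" "\<And>h. \<bar>h \<bullet> (K *v h)\<bar> \<le> (1 / 2 + c0) * (h \<bullet> (D *v h))" by blast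
  define L where "L = M + K"
  have tL: "transpose L = L" using tM K(1) by (simp add: L_def transpose_def vec_eq_iff)
  have Lv: "L *v v = w" using K(2) by (simp add: L_def matrix_vector_mult_add_rdistrib r_def)
  have lo: "h \<bullet> ((N - c0 *\<^sub>R D) *v h) \<le> h \<bullet> (L *v h)" for h
    using K(3)[of h] by (simp add: L_def mvs matrix_vector_mult_add_rdistrib matrix_vector_mult_diff_rdistrib Ne
       inner_add_right inner_diff_right abs_le_iff algebra_simps)
  have hi: "h \<bullet> (L *v h) \<le> h \<bullet> ((P + c0 *\<^sub>R D) *v h)" for h
    using K(3)[of h] by (simp add: L_def mvs matrix_vector_mult_add_rdistrib matrix_vector_mult_diff_rdistrib Pe
       inner_add_right inner_diff_right abs_le_iff algebra_simps)
  have t: "transpose (N - c0 *\<^sub>R D) = N - c0 *\<^sub>R D" "transpose (P + c0 *\<^sub>R D) = P + c0 *\<^sub>R D"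
    using P N tD by (simp_all add: transpose_def vec_eq_iff)
  have "lagrangian (matrix_graph L)"
    using transverse_lagrangian_matrix_graph[OF tL] by (simp add: transverse_lagrangian_def)
  moreover have "(v, w) \<in> matrix_graph L" using Lv by (auto simp: matrix_graph_def)
  ultimately show ?thesis
    unfolding vector_between_def D_def[symmetric]
    using lag_le_matrix_graph[OF t(1) tL lo] lag_le_matrix_graph[OF tL t(2) hi] by blast
qed

lemma tendsto_inner_matrix_vector:
  fixes A :: "nat \<Rightarrow> real ^ 'n ^ 'n"
  assumes "A \<longlonglongrightarrow> B" "x \<longlonglongrightarrow> x0" "y \<longlonglongrightarrow> y0"
  shows "(\<lambda>k. x k \<bullet> (A k *v y k)) \<longlonglongrightarrow> x0 \<bullet> (B *v y0)"
  unfolding inner_vec_def matrix_vector_mult_def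
  by (simp, intro tendsto_intros assms)

lemma quadratic_polarization:
  fixes A :: "real ^ 'n ^ 'n"
  assumes "transpose A = A"
  shows "A $ i $ j = ((axis i 1 + axis j 1) \<bullet> (A *v (axis i 1 + axis j 1)) - axis i 1 \<bullet> (A *v axis i 1)
    - axis j 1 \<bullet> (A *v axis j 1)) / 2"
proof -
  have "axis i 1 \<bullet> (A *v axis j 1) = A $ i $ j"
    by (simp add: matrix_vector_mult_basis column_def inner_axis')
  moreover have "axis j 1 \<bullet> (A *v axis i 1) = axis i 1 \<bullet> (A *v axis j 1)"
    using symmetric_inner[OF assms, of "axis j 1" "axis i 1"] by (simp add: inner_commute)
  ultimately show ?thesis by (simp add: matrix_vector_right_distrib inner_add_left inner_add_right)
qed

text \<open>
  Monotone convergence of the values of the quadratic forms passes to the entries by polarization.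
\<close>

lemma symmetric_decreasing_convergent:
  fixes A :: "nat \<Rightarrow> real ^ 'n ^ 'n"
  assumes sym: "\<And>k. transpose (A k) = A k"
    and dec: "\<And>k h. h \<bullet> (A (Suc k) *v h) \<le> h \<bullet> (A k *v h)"
    and bdd: "\<And>k h. b h \<le> h \<bullet> (A k *v h)"
  shows "\<exists>B. A \<longlonglongrightarrow> B \<and> transpose B = B"
proof -
  have conv: "convergent (\<lambda>k. h \<bullet> (A k *v h))" for h
  proof -
    have "decseq (\<lambda>k. h \<bullet> (A k *v h))" using dec by (simp add: decseq_Suc_iff)
    then show ?thesis using decseq_convergent[of _ "b h"] bdd[of h] by (metis convergent_def)
  qed
  define B where "B = (\<chi> i j. lim (\<lambda>k. A k $ i $ j))"
  obtain L where L: "\<And>h. (\<lambda>k. h \<bullet> (A k *v h)) \<longlonglongrightarrow> L h"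
    using conv unfolding convergent_def by metis
  have "(\<lambda>k. A k $ i $ j) \<longlonglongrightarrow> (L (axis i 1 + axis j 1) - L (axis i 1) - L (axis j 1)) / 2" for i j
    unfolding quadratic_polarization[OF sym] by (intro tendsto_intros L) auto
  then have "convergent (\<lambda>k. A k $ i $ j)" for i j
    unfolding convergent_def by blast
  then have ent: "(\<lambda>k. A k $ i $ j) \<longlonglongrightarrow> B $ i $ j" for i j
    by (simp add: B_def convergent_LIMSEQ_iff)
  then have lim: "A \<longlonglongrightarrow> B" by (intro vec_tendstoI)
  have "B $ i $ j = B $ j $ i" for i j
  proof -
    have "A k $ i $ j = A k $ j $ i" for k using sym[of k] by (metis transpose_def vec_lambda_beta)
    then show ?thesis using ent[of i j] ent[of j i] LIMSEQ_unique by fastforce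
  qed
  then have "transpose B = B" by (simp add: transpose_def vec_eq_iff)
  with lim show ?thesis by blast
qed

section \<open>Orthogonal projections and limits of subspaces\<close>

context
  fixes V :: "'a::euclidean_space set"
  assumes V: "subspace V"
begin

lemma closest_point_subspace_in: "closest_point V x \<in> V"
  using closest_point_in_set[OF closed_subspace[OF V]] subspace_0[OF V] by blast

lemma closest_point_subspace_orthogonal:
  assumes y: "y \<in> V"
  shows "(x - closest_point V x) \<bullet> y = 0"
proof -
  let ?p = "closest_point V x"
  have p: "?p \<in> V" by (rule closest_point_subspace_in)
  have "(x - ?p) \<bullet> (z - ?p) \<le> 0" if "z \<in> V" for z
    using closest_point_dot[OF subspace_imp_convex[OF V] closed_subspace[OF V] that] .
  from this[OF subspace_add[OF V p y]] this[OF subspace_diff[OF V p y]] show ?thesis by simp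
qed

lemma closest_point_subspace_unique:
  assumes "p \<in> V" "\<And>y. y \<in> V \<Longrightarrow> (x - p) \<bullet> y = 0"
  shows "closest_point V x = p"
proof -
  let ?d = "closest_point V x - p"
  have d: "?d \<in> V" by (rule subspace_diff[OF V closest_point_subspace_in assms(1)])
  have "?d \<bullet> ?d = (x - p) \<bullet> ?d - (x - closest_point V x) \<bullet> ?d" by (simp add: inner_diff_left)
  also have "\<dots> = 0" using assms(2)[OF d] closest_point_subspace_orthogonal[OF d] by simp
  finally show ?thesis by simp
qed

lemma linear_closest_point_subspace: "linear (closest_point V)"
proof (rule linearI)
  show "closest_point V (x + y) = closest_point V x + closest_point V y" for x y
    using closest_point_subspace_orthogonal[of _ x] closest_point_subspace_orthogonal[of _ y]
    by (intro closest_point_subspace_unique subspace_add[OF V] closest_point_subspace_in)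
       (simp add: algebra_simps)
  show "closest_point V (c *\<^sub>R x) = c *\<^sub>R closest_point V x" for c x
    using closest_point_subspace_orthogonal[of _ x]
    by (intro closest_point_subspace_unique subspace_scale[OF V] closest_point_subspace_in)
       (simp add: flip: scaleR_diff_right)
qed

lemma norm_diff_closest_point_subspace: "y \<in> V \<Longrightarrow> norm (x - closest_point V x) \<le> norm (x - y)"
  using closest_point_le[OF closed_subspace[OF V], of y x] by (simp add: dist_norm)

lemma norm_closest_point_subspace: "norm (closest_point V x) \<le> norm x"
proof -
  let ?p = "closest_point V x"
  have "(norm ?p)\<^sup>2 = ?p \<bullet> x"
    using closest_point_subspace_orthogonal[OF closest_point_subspace_in, of x x]
    by (simp add: power2_norm_eq_inner inner_diff_left inner_diff_right inner_commute)
  also have "\<dots> \<le> norm ?p * norm x" by (rule norm_cauchy_schwarz)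
  finally show ?thesis by (cases "norm ?p = 0") (auto simp: power2_eq_square)
qed

end

text \<open>
  For orthogonal projections \<open>P\<close> and \<open>P'\<close> one has \<open>P - P' = P (1 - P') - (1 - P) P'\<close>. The second
  summand is small because vectors of \<open>E'\<close> are close to \<open>E\<close>; the first is the adjoint of
  \<open>(1 - P') P\<close>, which is small because vectors of \<open>E\<close> are close to \<open>E'\<close>.
\<close>

lemma norm_closest_point_diff_le:
  fixes E E' :: "'a::euclidean_space set"
  assumes E: "subspace E" and E': "subspace E'"
    and close: "\<And>x. x \<in> E \<Longrightarrow> \<exists>y\<in>E'. norm (x - y) \<le> \<epsilon> * norm x"
      "\<And>y. y \<in> E' \<Longrightarrow> \<exists>x\<in>E. norm (y - x) \<le> \<epsilon> * norm y"
    and \<epsilon>: "\<epsilon> \<ge> 0"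
  shows "norm (closest_point E x - closest_point E' x) \<le> 2 * \<epsilon> * norm x"
proof -
  let ?P = "closest_point E" and ?P' = "closest_point E'"
  define y where "y = x - ?P' x"
  have y: "norm y \<le> norm x"
    using norm_diff_closest_point_subspace[OF E' subspace_0[OF E'], of x] by (simp add: y_def)
  obtain e' where e': "e' \<in> E'" "norm (?P y - e') \<le> \<epsilon> * norm (?P y)"
    using close(1)[OF closest_point_subspace_in[OF E]] by blast
  have "y \<bullet> e' = 0" unfolding y_def by (rule closest_point_subspace_orthogonal[OF E' e'(1)])
  moreover have "(norm (?P y))\<^sup>2 = ?P y \<bullet> y"
    using closest_point_subspace_orthogonal[OF E closest_point_subspace_in[OF E], of y y]
    by (simp add: power2_norm_eq_inner inner_diff_left inner_diff_right inner_commute)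
  ultimately have "(norm (?P y))\<^sup>2 = (?P y - e') \<bullet> y" by (simp add: inner_diff_left inner_diff_right inner_commute)
  also have "\<dots> \<le> norm (?P y - e') * norm y" by (rule norm_cauchy_schwarz)
  also have "\<dots> \<le> \<epsilon> * norm (?P y) * norm y" using e'(2) by (rule mult_right_mono) simp
  finally have "norm (?P y) * norm (?P y) \<le> norm (?P y) * (\<epsilon> * norm y)"
    by (simp add: power2_eq_square mult_ac)
  then have "norm (?P y) \<le> \<epsilon> * norm y"
  proof (cases "?P y = 0")
    case False
    then have "0 < norm (?P y)" by simp
    with \<open>norm (?P y) * norm (?P y) \<le> norm (?P y) * (\<epsilon> * norm y)\<close> show ?thesis
      by (rule mult_left_le_imp_le)
  qed (use \<epsilon> in simp)
  also have "\<dots> \<le> \<epsilon> * norm x" using y \<epsilon> by (rule mult_left_mono)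
  finally have 1: "norm (?P y) \<le> \<epsilon> * norm x" .
  obtain e where e: "e \<in> E" "norm (?P' x - e) \<le> \<epsilon> * norm (?P' x)"
    using close(2)[OF closest_point_subspace_in[OF E']] by blast
  have "norm (?P' x - ?P (?P' x)) \<le> norm (?P' x - e)" by (rule norm_diff_closest_point_subspace[OF E e(1)])
  also have "\<dots> \<le> \<epsilon> * norm (?P' x)" by (rule e(2))
  also have "\<dots> \<le> \<epsilon> * norm x" using norm_closest_point_subspace[OF E'] \<epsilon> by (rule mult_left_mono)
  finally have 2: "norm (?P' x - ?P (?P' x)) \<le> \<epsilon> * norm x" .
  have "?P x - ?P' x = ?P y - (?P' x - ?P (?P' x))"
    by (simp add: y_def linear_diff[OF linear_closest_point_subspace[OF E]])
  then have "norm (?P x - ?P' x) \<le> norm (?P y) + norm (?P' x - ?P (?P' x))"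
    using norm_triangle_ineq4 by metis
  with 1 2 show ?thesis by simp
qed

lemma subspace_limit_unique:
  fixes G :: "nat \<Rightarrow> 'a::euclidean_space set"
  assumes G: "\<And>k. subspace (G k)" and L: "subspace_limit G L" and L': "subspace_limit G L'"
  shows "L = L'"
proof -
  have sub: "subspace L" "subspace L'" using L L' by (auto simp: subspace_limit_def)
  have lim: "(\<lambda>k. closest_point (G k) x) \<longlonglongrightarrow> closest_point K x" if "subspace_limit G K" for K x
  proof -
    have K: "subspace K" "(\<lambda>k. onorm (\<lambda>v. closest_point (G k) v - closest_point K v)) \<longlonglongrightarrow> 0"
      using that by (auto simp: subspace_limit_def)
    have "norm (closest_point (G k) x - closest_point K x)
        \<le> onorm (\<lambda>v. closest_point (G k) v - closest_point K v) * norm x" for k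
      by (rule onorm, unfold linear_conv_bounded_linear[symmetric])
         (intro linear_compose_sub linear_closest_point_subspace G K)
    then have "(\<lambda>k. closest_point (G k) x - closest_point K x) \<longlonglongrightarrow> 0"
      by (intro Lim_null_comparison[OF _ tendsto_mult_left_zero[OF K(2)]] always_eventually) auto
    then show ?thesis by (rule LIM_zero_cancel)
  qed
  have "closest_point L x = closest_point L' x" for x
    using LIMSEQ_unique[OF lim[OF L] lim[OF L']] .
  then have "x \<in> L \<longleftrightarrow> x \<in> L'" for x
    using closest_point_refl[OF closed_subspace[OF sub(1)], of x] closest_point_refl[OF closed_subspace[OF sub(2)], of x]
      subspace_0[OF sub(1)] subspace_0[OF sub(2)] by (metis empty_iff)
  then show ?thesis by blast
qed

lemma subspace_limit_matrix_graph:
  fixes A :: "nat \<Rightarrow> real ^ 'n::finite ^ 'n"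
  assumes "A \<longlonglongrightarrow> B"
  shows "subspace_limit (\<lambda>k. matrix_graph (A k)) (matrix_graph B)"
proof -
  define \<epsilon> where "\<epsilon> k = (\<Sum>i\<in>UNIV. \<Sum>j\<in>UNIV. \<bar>(A k - B) $ i $ j\<bar>)" for k
  have "\<epsilon> \<longlonglongrightarrow> (\<Sum>i\<in>(UNIV :: 'n set). \<Sum>j\<in>(UNIV :: 'n set). \<bar>(B - B) $ i $ j\<bar>)"
    unfolding \<epsilon>_def[abs_def] by (intro tendsto_intros assms)
  then have \<epsilon>: "\<epsilon> \<longlonglongrightarrow> 0" by simp
  have \<epsilon>0: "\<epsilon> k \<ge> 0" for k unfolding \<epsilon>_def by (intro sum_nonneg) auto
  have bound: "norm ((A k - B) *v h) \<le> \<epsilon> k * norm h" for k h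
  proof -
    have "norm ((A k - B) *v h) \<le> onorm ((*v) (A k - B)) * norm h" by (intro onorm) simp
    also have "\<dots> \<le> \<epsilon> k * norm h"
      unfolding \<epsilon>_def by (intro mult_right_mono onorm_le_matrix_component_sum) simp
    finally show ?thesis .
  qed
  have fst_le: "norm h \<le> norm (h, h')" for h h' :: "real ^ 'n"
    using norm_fst_le[of h h'] by simp
  have near: "norm ((h, A k *v h) - (h, B *v h)) \<le> \<epsilon> k * norm h" for h k
    using bound[of k h] by (simp add: norm_prod_def matrix_vector_mult_diff_rdistrib)
  have on: "onorm (\<lambda>v. closest_point (matrix_graph (A k)) v - closest_point (matrix_graph B) v) \<le> 2 * \<epsilon> k" for k
  proof (rule onorm_le, rule norm_closest_point_diff_le)
    fix x assume "x \<in> matrix_graph (A k)"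
    then obtain h where x: "x = (h, A k *v h)" by (auto simp: matrix_graph_def)
    have "\<epsilon> k * norm h \<le> \<epsilon> k * norm x" unfolding x by (intro mult_left_mono fst_le \<epsilon>0)
    then show "\<exists>y\<in>matrix_graph B. norm (x - y) \<le> \<epsilon> k * norm x"
      using near[of h k] by (intro bexI[of _ "(h, B *v h)"]) (auto simp: x matrix_graph_def)
  next
    fix x assume "x \<in> matrix_graph B"
    then obtain h where x: "x = (h, B *v h)" by (auto simp: matrix_graph_def)
    have "\<epsilon> k * norm h \<le> \<epsilon> k * norm x" unfolding x by (intro mult_left_mono fst_le \<epsilon>0)
    then show "\<exists>y\<in>matrix_graph (A k). norm (x - y) \<le> \<epsilon> k * norm x"
      using near[of h k] unfolding norm_minus_commute[of "(h, A k *v h)"]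
      by (intro bexI[of _ "(h, A k *v h)"]) (auto simp: x matrix_graph_def)
  qed (auto intro: subspace_matrix_graph \<epsilon>0)
  have "(\<lambda>k. onorm (\<lambda>v. closest_point (matrix_graph (A k)) v - closest_point (matrix_graph B) v)) \<longlonglongrightarrow> 0"
  proof (rule Lim_null_comparison)
    show "(\<lambda>k. 2 * \<epsilon> k) \<longlonglongrightarrow> 0" using tendsto_mult_right_zero[OF \<epsilon>] by simp
    have bl: "bounded_linear (\<lambda>v. closest_point (matrix_graph (A k)) v - closest_point (matrix_graph B) v)" for k
      unfolding linear_conv_bounded_linear[symmetric]
      by (intro linear_compose_sub linear_closest_point_subspace subspace_matrix_graph)
    show "\<forall>\<^sub>F k in sequentially. norm (onorm (\<lambda>v. closest_point (matrix_graph (A k)) v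
        - closest_point (matrix_graph B) v)) \<le> 2 * \<epsilon> k"
      using on by (intro always_eventually allI) (simp add: onorm_pos_le[OF bl])
  qed
  then show ?thesis by (simp add: subspace_limit_def subspace_matrix_graph)
qed

text \<open>
  The sequences of Green iterates start with the vertical, which is not a graph; a limit does not
  see that first term.
\<close>

lemma the_subspace_limit_matrix_graph:
  fixes A :: "nat \<Rightarrow> real ^ 'n::finite ^ 'n"
  assumes "\<And>k. subspace (G k)" "\<And>k. G (Suc k) = matrix_graph (A k)" "A \<longlonglongrightarrow> B"
  shows "(THE L. subspace_limit G L) = matrix_graph B"
proof (rule the_equality)
  have "subspace_limit (\<lambda>k. G (Suc k)) (matrix_graph B)"
    using subspace_limit_matrix_graph[OF assms(3)] assms(2) by simp
  then show "subspace_limit G (matrix_graph B)"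
    unfolding subspace_limit_def by (auto intro: LIMSEQ_imp_Suc)
  then show "L = matrix_graph B" if "subspace_limit G L" for L
    using subspace_limit_unique assms(1) that by blast
qed

section \<open>Contingent and paratingent cones\<close>

text \<open>
  Bouligand's paratingent cone: limits of directions of secants whose two endpoints both move to
  \<open>a\<close>. Secants of length zero are admitted, so that the zero vector belongs to the cone. Estimates
  that are uniform in the base point see this cone directly, without the double limit in
  \<open>limit_contingent_cone\<close>.
\<close>

definition paratingent_cone :: "'a::real_normed_vector set \<Rightarrow> 'a \<Rightarrow> 'a set" where
  "paratingent_cone A a = {v. \<exists>x x' e W. (\<forall>k. x k \<in> A) \<and> x \<longlonglongrightarrow> a \<and> (\<forall>k. x' k \<in> A) \<and> x' \<longlonglongrightarrow> a \<and>
     e \<longlonglongrightarrow> (0 :: real) \<and> (\<forall>k. e k \<noteq> 0) \<and> W \<longlonglongrightarrow> v \<and> (\<forall>k. x' k = x k + e k *\<^sub>R W k)}"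

lemma zero_in_paratingent_cone:
  assumes "a \<in> A"
  shows "0 \<in> paratingent_cone A a"
proof -
  have e: "(\<lambda>k. inverse (real (Suc k))) \<longlonglongrightarrow> 0" by (rule LIMSEQ_inverse_real_of_nat)
  show ?thesis
    unfolding paratingent_cone_def using assms e
    by (intro CollectI exI[of _ "\<lambda>_. a"] exI[of _ "\<lambda>k. inverse (real (Suc k))"] exI[of _ "\<lambda>_. 0"]) auto
qed

text \<open>
  A diagonal argument: each contingent vector at a nearby point is replaced by a single secant that
  approximates it. If \<open>v\<close> is not zero, the scaling factors of the secants must tend to infinity.
\<close>

lemma limit_contingent_cone_paratingent:
  fixes A :: "'a::real_normed_vector set"
  assumes "v \<in> limit_contingent_cone A a" "a \<in> A"
  shows "v \<in> paratingent_cone A a"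
proof (cases "v = 0")
  case True
  then show ?thesis using zero_in_paratingent_cone[OF assms(2)] by simp
next
  case False
  obtain s w r where s: "\<And>k. s k \<in> A" "s \<longlonglongrightarrow> a" and w: "\<And>k. w k \<in> contingent_cone A (s k)"
    and r: "strict_mono (r :: nat \<Rightarrow> nat)" "(w \<circ> r) \<longlonglongrightarrow> v"
    using assms(1) unfolding limit_contingent_cone_def limit_points_def by blast
  define \<delta> where "\<delta> k = inverse (real (Suc k))" for k
  have \<delta>: "\<delta> k > 0" "\<delta> \<longlonglongrightarrow> 0" for k
    unfolding \<delta>_def using LIMSEQ_inverse_real_of_nat by auto
  have "\<exists>b t. b \<in> A \<and> norm (b - s (r k)) \<le> \<delta> k \<and> norm (t *\<^sub>R (b - s (r k)) - w (r k)) \<le> \<delta> k" for k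
  proof -
    obtain t y q where y: "\<And>i. y i \<in> A" "y \<longlonglongrightarrow> s (r k)"
      and q: "strict_mono (q :: nat \<Rightarrow> nat)" "((\<lambda>i. t i *\<^sub>R (y i - s (r k))) \<circ> q) \<longlonglongrightarrow> w (r k)"
      using w[of "r k"] unfolding contingent_cone_def limit_points_def by blast
    have "\<forall>\<^sub>F i in sequentially. dist ((y \<circ> q) i) (s (r k)) < \<delta> k"
      using LIMSEQ_subseq_LIMSEQ[OF y(2) q(1)] \<delta>(1) by (rule tendstoD)
    moreover have "\<forall>\<^sub>F i in sequentially. dist (((\<lambda>i. t i *\<^sub>R (y i - s (r k))) \<circ> q) i) (w (r k)) < \<delta> k"
      using q(2) \<delta>(1) by (rule tendstoD)
    ultimately have "\<forall>\<^sub>F i in sequentially. dist ((y \<circ> q) i) (s (r k)) < \<delta> k \<and>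
        dist (((\<lambda>i. t i *\<^sub>R (y i - s (r k))) \<circ> q) i) (w (r k)) < \<delta> k" by (rule eventually_conj)
    then obtain i where "dist (y (q i)) (s (r k)) < \<delta> k" "dist (t (q i) *\<^sub>R (y (q i) - s (r k))) (w (r k)) < \<delta> k"
      by (auto simp: eventually_sequentially)
    then show ?thesis using y(1) by (intro exI[of _ "y (q i)"] exI[of _ "t (q i)"]) (auto simp: dist_norm)
  qed
  then obtain b t where b: "\<And>k. b k \<in> A" "\<And>k. norm (b k - s (r k)) \<le> \<delta> k"
    "\<And>k. norm (t k *\<^sub>R (b k - s (r k)) - w (r k)) \<le> \<delta> k" by metis
  define x where "x k = s (r k)" for k
  define V where "V k = t k *\<^sub>R (b k - x k)" for k
  have x: "x \<longlonglongrightarrow> a" using LIMSEQ_subseq_LIMSEQ[OF s(2) r(1)] by (simp add: x_def[abs_def] o_def)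
  have d: "(\<lambda>k. b k - x k) \<longlonglongrightarrow> 0"
    using b(2) by (intro Lim_null_comparison[OF _ \<delta>(2)] always_eventually) (simp add: x_def)
  have b_lim: "b \<longlonglongrightarrow> a" using tendsto_add[OF d x] by simp
  have "(\<lambda>k. V k - w (r k)) \<longlonglongrightarrow> 0"
    using b(3) by (intro Lim_null_comparison[OF _ \<delta>(2)] always_eventually) (simp add: x_def V_def)
  from tendsto_add[OF this r(2)] have V: "V \<longlonglongrightarrow> v" by (simp add: o_def)
  then have "\<forall>\<^sub>F k in sequentially. V k \<noteq> 0" using False by (rule tendsto_imp_eventually_ne)
  then obtain N where N: "\<And>k. k \<ge> N \<Longrightarrow> V k \<noteq> 0" by (auto simp: eventually_sequentially)
  define e where "e k = inverse (t k)" for k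
  have t: "t k \<noteq> 0" if "k \<ge> N" for k using N[OF that] by (auto simp: V_def)
  have eV: "b k = x k + e k *\<^sub>R V k" if "k \<ge> N" for k using t[OF that] by (simp add: V_def e_def)
  have "(\<lambda>k. norm (b k - x k) / norm (V k)) \<longlonglongrightarrow> 0 / norm v"
    using False tendsto_norm_zero[OF d] by (intro tendsto_divide tendsto_norm V) auto
  then have lim: "(\<lambda>k. norm (b k - x k) / norm (V k)) \<longlonglongrightarrow> 0" by simp
  have ev: "\<forall>\<^sub>F k in sequentially. norm (e k) \<le> norm (b k - x k) / norm (V k)"
  proof (rule eventually_sequentiallyI)
    fix k assume "k \<ge> N"
    then have "b k - x k = e k *\<^sub>R V k" "V k \<noteq> 0" using eV N by auto
    then show "norm (e k) \<le> norm (b k - x k) / norm (V k)" by simp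
  qed
  have e: "e \<longlonglongrightarrow> 0" by (rule Lim_null_comparison[OF ev lim])
  show ?thesis
    unfolding paratingent_cone_def
  proof (intro CollectI exI conjI allI)
    show "(\<lambda>k. x (k + N)) \<longlonglongrightarrow> a" "(\<lambda>k. b (k + N)) \<longlonglongrightarrow> a" "(\<lambda>k. e (k + N)) \<longlonglongrightarrow> 0" "(\<lambda>k. V (k + N)) \<longlonglongrightarrow> v"
      using x b_lim e V by (simp_all add: LIMSEQ_ignore_initial_segment)
    show "x (k + N) \<in> A" "b (k + N) \<in> A" for k unfolding x_def by (rule s(1) b(1))+
    show "e (k + N) \<noteq> 0" "b (k + N) = x (k + N) + e (k + N) *\<^sub>R V (k + N)" for k
      using t[of "k + N"] eV[of "k + N"] by (simp_all add: e_def)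
  qed
qed

section \<open>Maps with a generating function\<close>

lemma funpow_has_derivative:
  fixes F :: "'a::real_normed_vector \<Rightarrow> 'a"
  assumes "\<And>z. (F has_derivative DF z) (at z)"
  shows "\<exists>D. (F ^^ k has_derivative D) (at z)"
proof (induction k arbitrary: z)
  case 0
  have "F ^^ 0 = (\<lambda>z. z)" by auto
  then show ?case using has_derivative_ident by metis
next
  case (Suc k)
  obtain D where "(F ^^ k has_derivative D) (at z)" using Suc by blast
  then have "(F \<circ> F ^^ k has_derivative DF ((F ^^ k) z) \<circ> D) (at z)"
    by (intro diff_chain_at assms)
  then show ?case unfolding funpow.simps by blast
qed

text \<open>
  \<open>S1 x\<close> and \<open>S2 x\<close> are the first and second derivative of \<open>S\<close> at \<open>x = (q, Q)\<close>. They are kept as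
  curried functions of the tangent vectors, so that reversing time amounts to composing them with
  \<open>prod.swap\<close>.
\<close>

locale generated_map =
  fixes F F' :: "'n::finite plane \<Rightarrow> 'n plane"
    and DF DF' :: "'n plane \<Rightarrow> 'n plane \<Rightarrow> 'n plane"
    and S :: "'n plane \<Rightarrow> real"
    and S1 :: "'n plane \<Rightarrow> 'n plane \<Rightarrow> real"
    and S2 :: "'n plane \<Rightarrow> 'n plane \<Rightarrow> 'n plane \<Rightarrow> real"
  assumes F'_F: "F' (F z) = z" and F_F': "F (F' z) = z"
    and F_deriv: "(F has_derivative DF z) (at z)"
    and F'_deriv: "(F' has_derivative DF' z) (at z)"
    and S_deriv: "(S has_derivative S1 x) (at x)"
    and S1_deriv: "((\<lambda>x. S1 x b) has_derivative (\<lambda>a. S2 x a b)) (at x)"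
    and S2_cont: "continuous_on UNIV (\<lambda>(x, a, b). S2 x a b)"
    and gen: "F (q, p) = (Q, P) \<longleftrightarrow> (\<forall>w. S1 (q, Q) w = P \<bullet> snd w - p \<bullet> fst w)"
    and connect: "\<exists>p P. F (q, p) = (Q, P)"
begin

text \<open>
  The point \<open>(q, Q)\<close> at which the derivative of \<open>S\<close> encodes the momenta of \<open>z\<close> and of \<open>F z\<close>.
\<close>

definition step :: "'n plane \<Rightarrow> 'n plane" where
  "step z = (fst z, fst (F z))"

lemma S1_step: "S1 (step z) w = snd (F z) \<bullet> snd w - snd z \<bullet> fst w"
  using gen[of "fst z" "snd z" "fst (F z)" "snd (F z)"] by (cases w) (simp add: step_def)

lemma linear_DF: "linear (DF z)"
  using F_deriv has_derivative_linear by blast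

lemma DF'_DF: "DF' (F z) (DF z v) = v"
proof -
  have "(F' \<circ> F has_derivative DF' (F z) \<circ> DF z) (at z)"
    by (intro diff_chain_at F_deriv F'_deriv)
  moreover have "F' \<circ> F = (\<lambda>z. z)" by (auto simp: F'_F)
  ultimately have "((\<lambda>z. z) has_derivative DF' (F z) \<circ> DF z) (at z)" by simp
  then have "DF' (F z) \<circ> DF z = (\<lambda>v. v)"
    using has_derivative_ident has_derivative_unique by blast
  then show ?thesis by (metis comp_apply)
qed

lemma inj_DF: "inj (DF z)"
  by (metis DF'_DF injI)

text \<open>
  The linearized form of \<open>gen\<close>: the second derivative of \<open>S\<close> at \<open>(q, Q)\<close> is to tangent vectors what
  the first derivative is to points. It comes from differentiating \<open>S1_step\<close>.
\<close>

lemma tangent: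
  "S2 (step z) (fst x, fst (DF z x)) w = snd (DF z x) \<bullet> snd w - snd x \<bullet> fst w"
proof -
  have s: "(step has_derivative (\<lambda>x. (fst x, fst (DF z x)))) (at z)"
    unfolding step_def[abs_def] by (auto intro!: derivative_eq_intros F_deriv)
  have "((\<lambda>x. S1 x w) \<circ> step has_derivative (\<lambda>a. S2 (step z) a w) \<circ> (\<lambda>x. (fst x, fst (DF z x)))) (at z)"
    by (intro diff_chain_at s S1_deriv)
  moreover have "((\<lambda>x. S1 x w) \<circ> step has_derivative (\<lambda>x. snd (DF z x) \<bullet> snd w - snd x \<bullet> fst w)) (at z)"
    unfolding o_def S1_step by (auto intro!: derivative_eq_intros F_deriv)
  ultimately show ?thesis
    using has_derivative_unique by (fastforce simp: o_def fun_eq_iff)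
qed

lemma linear_S2: "linear (\<lambda>a. S2 x a b)"
  using S1_deriv has_derivative_linear by blast

lemma S2_zero [simp]: "S2 x 0 b = 0"
  using linear_0[OF linear_S2] by simp

lemma vertical_step: "fst (DF z (0, p)) = 0 \<Longrightarrow> p = 0"
  using tangent[of z "(0, p)" "(p, 0)"] S2_zero by (simp flip: zero_prod_def)

text \<open>
  A momentum variation that leaves the image point at rest must vanish, so that momentum variations
  correspond bijectively to variations of the image point.
\<close>

lemma connect_tangent: "\<exists>p. fst (DF z (h', p)) = h"
proof -
  define f where "f p = fst (DF z (0, p))" for p
  have pr: "linear (\<lambda>p::real^'n. (0::real^'n, p))"
    by (auto simp: linear_iff)
  have lf: "linear f"
    unfolding f_def[abs_def]
    using linear_compose[OF linear_compose[OF pr linear_DF] linear_fst] by (simp add: o_def)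
  have "inj f"
    unfolding linear_injective_0[OF lf] using vertical_step f_def by auto
  then have "surj f" using lf linear_injective_imp_surjective by blast
  then obtain p where "f p = h - fst (DF z (h', 0))" by (metis surjD)
  moreover have "DF z (h', p) = DF z (h', 0) + DF z (0, p)"
    by (simp add: linear_add[OF linear_DF, symmetric])
  ultimately have "fst (DF z (h', p)) = h" by (simp add: f_def)
  then show ?thesis ..
qed

lemma step_surj: "\<exists>z. step z = x"
  using connect[of "fst x" "snd x"] unfolding step_def by (metis fst_conv prod.collapse)

text \<open>
  By \<open>tangent\<close>, the defect of symmetry of the second derivative, evaluated at the base parts of two
  tangent orbits, is the change of \<open>omega\<close> along these orbits.
\<close>

lemma S2_sym_if_symplectic:
  assumes "\<And>z u v. omega (DF z u) (DF z v) = omega u v"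
  shows "S2 x a b = S2 x b a"
proof -
  obtain z where z: "step z = x" using step_surj by blast
  obtain p where p: "fst (DF z (fst a, p)) = snd a" using connect_tangent by blast
  obtain r where r: "fst (DF z (fst b, r)) = snd b" using connect_tangent by blast
  have "S2 x a b = snd (DF z (fst a, p)) \<bullet> snd b - p \<bullet> fst b"
    using tangent[of z "(fst a, p)" b] z p by simp
  moreover have "S2 x b a = snd (DF z (fst b, r)) \<bullet> snd a - r \<bullet> fst a"
    using tangent[of z "(fst b, r)" a] z r by simp
  moreover have "omega (DF z (fst a, p)) (DF z (fst b, r)) = omega (fst a, p) (fst b, r)"
    by (rule assms)
  ultimately show ?thesis by (simp add: omega_def p r inner_commute)
qed

definition green :: "nat \<Rightarrow> 'n plane \<Rightarrow> 'n plane set" where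
  "green k z = frechet_derivative (F ^^ k) (at ((F' ^^ k) z)) ` vertical"

lemmas funpow_deriv = funpow_has_derivative[of F DF, OF F_deriv]

lemma funpow_F_F': "(F ^^ k) ((F' ^^ k) z) = z"
  by (induction k arbitrary: z) (auto simp: F_F' funpow_swap1)

lemma green_0: "green 0 z = vertical"
proof -
  have "frechet_derivative (\<lambda>x::'n plane. x) (at z) = (\<lambda>x. x)"
    using frechet_derivative_at[OF has_derivative_ident, of z] by simp
  then show ?thesis by (simp add: green_def id_def)
qed

lemma green_Suc: "green (Suc k) z = DF (F' z) ` green k (F' z)"
proof -
  let ?w = "(F' ^^ k) (F' z)"
  obtain D where D: "(F ^^ k has_derivative D) (at ?w)" using funpow_deriv by blast
  then have "(F \<circ> F ^^ k has_derivative DF ((F ^^ k) ?w) \<circ> D) (at ?w)"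
    by (intro diff_chain_at F_deriv)
  then have 1: "(F ^^ Suc k has_derivative DF (F' z) \<circ> D) (at ?w)"
    by (simp add: funpow_F_F')
  have w: "(F' ^^ Suc k) z = ?w" by (simp add: funpow_swap1)
  show ?thesis
    unfolding green_def w frechet_derivative_at[OF 1, symmetric] frechet_derivative_at[OF D, symmetric]
    by (simp add: image_comp)
qed

lemma subspace_vertical: "subspace (vertical :: 'n plane set)"
  by (auto simp: subspace_def vertical_def)

lemma dim_vertical: "dim (vertical :: 'n plane set) = CARD('n)"
proof -
  have pr: "linear (\<lambda>p::real^'n. (0::real^'n, p))"
    by (auto simp: linear_iff)
  have "(\<lambda>p::real^'n. (0::real^'n, p)) ` UNIV = vertical"
    by (force simp: vertical_def)
  moreover have "dim ((\<lambda>p::real^'n. (0::real^'n, p)) ` UNIV) = dim (UNIV :: (real^'n) set)"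
    by (rule dim_image_eq[OF pr]) (auto intro: injI)
  ultimately show ?thesis by (simp add: dim_UNIV)
qed

lemma subspace_green: "subspace (green k z)"
  by (induction k arbitrary: z)
    (simp_all add: green_0 green_Suc subspace_vertical linear_subspace_image[OF linear_DF])

lemma dim_green: "dim (green k z) = CARD('n)"
proof (induction k arbitrary: z)
  case 0
  then show ?case by (simp add: green_0 dim_vertical)
next
  case (Suc k)
  then show ?case unfolding green_Suc
    by (subst dim_image_eq[OF linear_DF]) (auto intro: inj_on_subset[OF inj_DF])
qed

end

section \<open>Calibrated sets and second-order bounds\<close>

text \<open>
  \<open>u\<close> plays the role of a weak KAM solution: it grows along any step by at most the action of that
  step, with equality for orbits in the invariant set \<open>M\<close>. The two together control \<open>u\<close> to second
  order near the projection of \<open>M\<close>.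
\<close>

locale calibrated = generated_map F F' DF DF' S S1 S2
  for F F' :: "'n::finite plane \<Rightarrow> 'n plane" and DF DF' S S1 S2 +
  fixes M :: "'n plane set" and u :: "real ^ 'n \<Rightarrow> real" and c :: real
  assumes S2_sym: "S2 x a b = S2 x b a"
    and M_inv: "F z \<in> M \<longleftrightarrow> z \<in> M"
    and subsolution: "u y \<le> u y' + S (y', y) - c"
    and calibration: "z \<in> M \<Longrightarrow> u (fst (F z)) = u (fst z) + S (fst z, fst (F z)) - c"
begin

lemma linear_S2': "linear (S2 x a)"
proof -
  have "S2 x a = (\<lambda>b. S2 x b a)" using S2_sym by blast
  with linear_S2[of x a] show ?thesis by simp
qed

lemmas S2_add = linear_add[OF linear_S2] linear_add[OF linear_S2']
lemmas S2_scale = linear_scale[OF linear_S2, simplified] linear_scale[OF linear_S2', simplified]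

lemma S2_tendsto:
  assumes "x \<longlonglongrightarrow> a" "v \<longlonglongrightarrow> w"
  shows "(\<lambda>k. S2 (x k) (v k) (v k)) \<longlonglongrightarrow> S2 a w w"
proof -
  have "isCont (\<lambda>(x, a, b). S2 x a b) (a, w, w)"
    using S2_cont unfolding continuous_on_eq_continuous_at[OF open_UNIV] by blast
  moreover have "(\<lambda>k. (x k, v k, v k)) \<longlonglongrightarrow> (a, w, w)" by (intro tendsto_intros assms)
  ultimately show ?thesis using isCont_tendsto_compose by fastforce
qed

lemma taylor_step:
  "\<exists>t. 0 < t \<and> t < 1 \<and> S (x + e *\<^sub>R w) = S x + e * S1 x w + e\<^sup>2 / 2 * S2 (x + (t * e) *\<^sub>R w) w w"
proof -
  define d where "d m (t::real) = (if m = 0 then S (x + t *\<^sub>R (e *\<^sub>R w)) else if m = 1 then S1 (x + t *\<^sub>R (e *\<^sub>R w)) (e *\<^sub>R w)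
     else S2 (x + t *\<^sub>R (e *\<^sub>R w)) (e *\<^sub>R w) (e *\<^sub>R w))" for m :: nat and t :: real
  have line: "((\<lambda>t. x + t *\<^sub>R (e *\<^sub>R w)) has_derivative (\<lambda>t. t *\<^sub>R (e *\<^sub>R w))) (at t)" for t
    by (auto intro!: derivative_eq_intros)
  have lin1: "linear (S1 x)" for x using S_deriv has_derivative_linear by blast
  have der0: "DERIV (d 0) t :> d (Suc 0) t" for t
    unfolding d_def has_field_derivative_def
    using diff_chain_at[OF line[of t] S_deriv]
    by (simp add: o_def linear_scale[OF lin1] mult_ac mult_commute_abs)
  have der1: "DERIV (d (Suc 0)) t :> d (Suc (Suc 0)) t" for t
    unfolding d_def has_field_derivative_def
    using diff_chain_at[OF line[of t] S1_deriv]
    by (simp add: o_def linear_scale[OF linear_S2] mult_ac mult_commute_abs)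
  have "\<exists>t>0. t < 1 \<and> d 0 1 = (\<Sum>m<2. d m 0 / fact m * 1 ^ m) + d 2 t / fact 2 * 1 ^ 2"
    by (rule Maclaurin) (auto simp: less_2_cases_iff der0 der1)
  then obtain t where t: "0 < t" "t < 1" "d 0 1 = (\<Sum>m<2. d m 0 / fact m * 1 ^ m) + d 2 t / fact 2 * 1 ^ 2"
    by blast
  have "S (x + e *\<^sub>R w) = S x + e * S1 x w + e\<^sup>2 / 2 * S2 (x + (t * e) *\<^sub>R w) w w"
    using t(3) by (simp add: d_def numeral_2_eq_2 S2_scale linear_scale[OF lin1] power2_eq_square)
  then show ?thesis using t by blast
qed

text \<open>
  The base point may move with \<open>k\<close> as long as it converges; this uniformity is what lets the
  estimates reach the paratingent cone.
\<close>

lemma taylor: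
  assumes x: "x \<longlonglongrightarrow> a" and e: "e \<longlonglongrightarrow> (0::real)" and w: "w \<longlonglongrightarrow> w0" and d: "d > 0"
  shows "\<forall>\<^sub>F k in sequentially.
    \<bar>S (x k + e k *\<^sub>R w k) - S (x k) - e k * S1 (x k) (w k) - (e k)\<^sup>2 / 2 * S2 a w0 w0\<bar> \<le> (e k)\<^sup>2 * d"
proof -
  have "\<forall>k. \<exists>t. 0 < t \<and> t < 1 \<and> S (x k + e k *\<^sub>R w k) = S (x k) + e k * S1 (x k) (w k)
      + (e k)\<^sup>2 / 2 * S2 (x k + (t * e k) *\<^sub>R w k) (w k) (w k)"
    using taylor_step by blast
  then obtain t where t: "\<And>k. 0 < t k \<and> t k < 1 \<and> S (x k + e k *\<^sub>R w k) = S (x k) + e k * S1 (x k) (w k)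
      + (e k)\<^sup>2 / 2 * S2 (x k + (t k * e k) *\<^sub>R w k) (w k) (w k)"
    by (auto dest!: choice)
  have "(\<lambda>k. t k * e k) \<longlonglongrightarrow> 0"
  proof (rule Lim_null_comparison[OF _ tendsto_rabs_zero[OF e]])
    show "\<forall>\<^sub>F k in sequentially. norm (t k * e k) \<le> \<bar>e k\<bar>"
      using t by (intro always_eventually allI) (simp add: abs_mult mult_left_le_one_le less_imp_le)
  qed
  then have "(\<lambda>k. x k + (t k * e k) *\<^sub>R w k) \<longlonglongrightarrow> a + 0 *\<^sub>R w0"
    by (intro tendsto_intros x w)
  then have "(\<lambda>k. S2 (x k + (t k * e k) *\<^sub>R w k) (w k) (w k)) \<longlonglongrightarrow> S2 a w0 w0"
    by (intro S2_tendsto w) simp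
  then have "\<forall>\<^sub>F k in sequentially. dist (S2 (x k + (t k * e k) *\<^sub>R w k) (w k) (w k)) (S2 a w0 w0) < 2 * d"
    using d by (intro tendstoD) auto
  then show ?thesis
  proof (rule eventually_mono)
    fix k
    let ?s = "S2 (x k + (t k * e k) *\<^sub>R w k) (w k) (w k)"
    assume "dist ?s (S2 a w0 w0) < 2 * d"
    then have "\<bar>?s - S2 a w0 w0\<bar> \<le> 2 * d" by (simp add: dist_real_def)
    then have "(e k)\<^sup>2 / 2 * \<bar>?s - S2 a w0 w0\<bar> \<le> (e k)\<^sup>2 / 2 * (2 * d)"
      by (intro mult_left_mono) auto
    moreover have "S (x k + e k *\<^sub>R w k) - S (x k) - e k * S1 (x k) (w k) - (e k)\<^sup>2 / 2 * S2 a w0 w0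
       = (e k)\<^sup>2 / 2 * (?s - S2 a w0 w0)" using t[of k] by (simp add: algebra_simps)
    moreover have "\<bar>(e k)\<^sup>2 / 2 * (?s - S2 a w0 w0)\<bar> = (e k)\<^sup>2 / 2 * \<bar>?s - S2 a w0 w0\<bar>"
      unfolding abs_mult by simp
    ultimately show "\<bar>S (x k + e k *\<^sub>R w k) - S (x k) - e k * S1 (x k) (w k) - (e k)\<^sup>2 / 2 * S2 a w0 w0\<bar> \<le> (e k)\<^sup>2 * d"
      by simp
  qed
qed

text \<open>
  \<open>C\<close> bounds from above the second derivative of \<open>u\<close> in the direction \<open>h\<close>, the gradient at a point
  of \<open>M\<close> being its momentum. The bound is uniform: base points in \<open>M\<close> converging to \<open>a\<close>, step
  lengths of either sign and directions converging to \<open>h\<close> are all allowed to vary together.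
\<close>

definition upper_at :: "'n plane \<Rightarrow> real ^ 'n \<Rightarrow> real \<Rightarrow> bool" where
  "upper_at a h C \<longleftrightarrow> (\<forall>x e hs d. (\<forall>k. x k \<in> M) \<longrightarrow> x \<longlonglongrightarrow> a \<longrightarrow> e \<longlonglongrightarrow> 0 \<longrightarrow> hs \<longlonglongrightarrow> h \<longrightarrow> d > 0 \<longrightarrow>
     (\<forall>\<^sub>F k in sequentially.
        u (fst (x k) + e k *\<^sub>R hs k) \<le> u (fst (x k)) + e k * (snd (x k) \<bullet> hs k) + (e k)\<^sup>2 * (C / 2 + d)))"

lemma upper_atD:
  assumes "upper_at a h C" "\<And>k. x k \<in> M" "x \<longlonglongrightarrow> a" "e \<longlonglongrightarrow> 0" "hs \<longlonglongrightarrow> h" "d > 0"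
  shows "\<forall>\<^sub>F k in sequentially.
        u (fst (x k) + e k *\<^sub>R hs k) \<le> u (fst (x k)) + e k * (snd (x k) \<bullet> hs k) + (e k)\<^sup>2 * (C / 2 + d)"
  using assms unfolding upper_at_def by blast

text \<open>
  Push a bound one step forward: \<open>u (Q + e h) \<le> u (q + e h') + S (q + e h', Q + e h) - c\<close> with
  equality at \<open>e = 0\<close>. The momentum at \<open>q\<close> occurs with opposite signs in the two terms on the right,
  so the terms of first order leave only the momentum at \<open>Q\<close>, and the second-order terms add up. The
  hypothesis only concerns the constant direction \<open>h'\<close>, so that it also covers \<open>h' = 0\<close>, where
  nothing needs to be known about \<open>u\<close> off \<open>M\<close>.
\<close>

lemma upper_step:
  assumes prev: "\<And>(x :: nat \<Rightarrow> 'n plane) (e :: nat \<Rightarrow> real) d. \<lbrakk>\<And>k. x k \<in> M; x \<longlonglongrightarrow> a; e \<longlonglongrightarrow> 0; d > 0\<rbrakk> \<Longrightarrow> \<forall>\<^sub>F k in sequentially.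
        u (fst (x k) + e k *\<^sub>R h') \<le> u (fst (x k)) + e k * (snd (x k) \<bullet> h') + (e k)\<^sup>2 * (C / 2 + d)"
  shows "upper_at (F a) h (C + S2 (step a) (h', h) (h', h))"
  unfolding upper_at_def
proof (intro allI impI)
  fix x :: "nat \<Rightarrow> 'n plane" and e :: "nat \<Rightarrow> real" and hs and d :: real
  assume x: "\<forall>k. x k \<in> M" "x \<longlonglongrightarrow> F a" and e: "e \<longlonglongrightarrow> 0" and hs: "hs \<longlonglongrightarrow> h" and d: "d > 0"
  define y where "y k = F' (x k)" for k
  have Fy: "F (y k) = x k" for k by (simp add: y_def F_F')
  have yM: "y k \<in> M" for k using x(1) M_inv Fy by metis
  have "isCont F' (F a)" "isCont F a" using F'_deriv F_deriv has_derivative_continuous by blast+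
  then have y: "y \<longlonglongrightarrow> a"
    unfolding y_def[abs_def] using isCont_tendsto_compose[OF _ x(2), of F'] by (simp add: F'_F)
  then have st: "(\<lambda>k. step (y k)) \<longlonglongrightarrow> step a"
    unfolding step_def using \<open>isCont F a\<close>
    by (intro tendsto_intros isCont_tendsto_compose[of a F])
  have w: "(\<lambda>k. (h', hs k)) \<longlonglongrightarrow> (h', h)" by (intro tendsto_intros hs)
  have "d / 2 > 0" using d by simp
  from prev[where x = y, OF yM y e this] taylor[OF st e w this]
  show "\<forall>\<^sub>F k in sequentially. u (fst (x k) + e k *\<^sub>R hs k) \<le> u (fst (x k)) + e k * (snd (x k) \<bullet> hs k)
      + (e k)\<^sup>2 * ((C + S2 (step a) (h', h) (h', h)) / 2 + d)"
  proof eventually_elim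
    case (elim k)
    let ?q = "fst (y k)" and ?Q = "fst (x k)"
    have "u (?Q + e k *\<^sub>R hs k) \<le> u (?q + e k *\<^sub>R h') + S (?q + e k *\<^sub>R h', ?Q + e k *\<^sub>R hs k) - c"
      by (rule subsolution)
    moreover have "u ?Q = u ?q + S (step (y k)) - c"
      using calibration[OF yM, of k] Fy by (simp add: step_def)
    moreover have "step (y k) + e k *\<^sub>R (h', hs k) = (?q + e k *\<^sub>R h', ?Q + e k *\<^sub>R hs k)"
      by (simp add: step_def Fy)
    moreover have "e k * S1 (step (y k)) (h', hs k) = e k * (snd (x k) \<bullet> hs k) - e k * (snd (y k) \<bullet> h')"
      by (simp add: S1_step Fy right_diff_distrib)
    ultimately show ?case using elim unfolding abs_le_iff by (simp add: distrib_left add_divide_distrib)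
  qed
qed

lemma upper_step_base: "upper_at (F a) h (S2 (step a) (0, h) (0, h))"
  using upper_step[where h' = 0 and C = 0 and a = a and h = h] by simp

lemma upper_step':
  assumes "upper_at a h' C"
  shows "upper_at (F a) h (C + S2 (step a) (h', h) (h', h))"
  by (rule upper_step) (intro upper_atD[OF assms] tendsto_const)

lemma S2_tangent: "S2 (step z) (fst x, fst (DF z x)) (fst x, fst (DF z x))
    = fst (DF z x) \<bullet> snd (DF z x) - fst x \<bullet> snd x"
  by (simp add: tangent inner_commute)

text \<open>
  Along a tangent orbit the second-order terms telescope: by \<open>S2_tangent\<close> each step contributes the
  increment of \<open>h \<bullet> \<pi>\<close>, and this product vanishes on the vertical, where the orbit starts. Hence the
  slope of \<open>green (Suc k) a\<close> bounds the Hessian of \<open>u\<close> from above.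
\<close>

lemma upper_green:
  assumes "x \<in> green (Suc k) a"
  shows "upper_at a (fst x) (fst x \<bullet> snd x)"
  using assms
proof (induction k arbitrary: x a)
  case 0
  then obtain p where "x = DF (F' a) (0, p)" by (auto simp: green_0 green_Suc vertical_def)
  then show ?case using upper_step_base[of "F' a" "fst x"] S2_tangent[of "F' a" "(0, p)"]
    by (simp add: F_F')
next
  case (Suc k)
  then obtain y where y: "y \<in> green (Suc k) (F' a)" "x = DF (F' a) y" unfolding green_Suc[of "Suc k"] by auto
  show ?case using upper_step'[OF Suc.IH[OF y(1)], of "fst x"] S2_tangent[of "F' a" y] y(2)
    by (simp add: F_F')
qed

text \<open>
  Going one step forward while keeping the image point fixed bounds \<open>u\<close> from below, with
  \<open>- S2 (step a) (h, 0) (h, 0)\<close> as second-order coefficient.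
\<close>

lemma upper_ge:
  assumes "a \<in> M" "upper_at a h C"
  shows "0 \<le> C + S2 (step a) (h, 0) (h, 0)"
proof (rule ccontr)
  assume neg: "\<not> ?thesis"
  define d where "d = - (C + S2 (step a) (h, 0) (h, 0)) / 8"
  have d: "d > 0" using neg by (simp add: d_def)
  define e where "e k = inverse (real (Suc k))" for k
  have e: "e \<longlonglongrightarrow> 0" unfolding e_def by (rule LIMSEQ_inverse_real_of_nat)
  have "\<forall>\<^sub>F k in sequentially. u (fst a + e k *\<^sub>R h) \<le> u (fst a) + e k * (snd a \<bullet> h) + (e k)\<^sup>2 * (C / 2 + d)"
    using upper_atD[OF assms(2) _ tendsto_const e tendsto_const d] assms(1) by auto
  moreover have "\<forall>\<^sub>F k in sequentially. \<bar>S (step a + e k *\<^sub>R (h, 0)) - S (step a) - e k * S1 (step a) (h, 0)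
      - (e k)\<^sup>2 / 2 * S2 (step a) (h, 0) (h, 0)\<bar> \<le> (e k)\<^sup>2 * d"
    by (rule taylor[OF tendsto_const e tendsto_const d])
  ultimately have "\<forall>\<^sub>F k in sequentially. False"
  proof eventually_elim
    case (elim k)
    have "u (fst (F a)) \<le> u (fst a + e k *\<^sub>R h) + S (fst a + e k *\<^sub>R h, fst (F a)) - c"
      by (rule subsolution)
    moreover have "step a + e k *\<^sub>R (h, 0) = (fst a + e k *\<^sub>R h, fst (F a))" by (simp add: step_def)
    moreover have "S1 (step a) (h, 0) = - (snd a \<bullet> h)" by (simp add: S1_step)
    ultimately have "0 \<le> (e k)\<^sup>2 * (C / 2 + d) + (e k)\<^sup>2 / 2 * S2 (step a) (h, 0) (h, 0) + (e k)\<^sup>2 * d"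
      using elim calibration[OF assms(1)] by (simp add: abs_le_iff algebra_simps step_def)
    also have "\<dots> = (e k)\<^sup>2 * (- 2 * d)"
      by (simp add: d_def field_simps)
    also have "\<dots> < 0" using d by (rule_tac mult_pos_neg) (simp_all add: e_def del: of_nat_Suc)
    finally show ?case by simp
  qed
  then show False by simp
qed

lemma omega_DF: "omega (DF z x) (DF z y) = omega x y"
proof -
  have "S2 (step z) (fst x, fst (DF z x)) (fst y, fst (DF z y)) = S2 (step z) (fst y, fst (DF z y)) (fst x, fst (DF z x))"
    by (rule S2_sym)
  then show ?thesis by (simp add: tangent omega_def inner_commute)
qed

lemma green_isotropic: "x \<in> green k a \<Longrightarrow> y \<in> green k a \<Longrightarrow> omega x y = 0"
proof (induction k arbitrary: x y a)
  case 0
  then show ?case by (simp add: green_0 vertical_def omega_def)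
next
  case (Suc k)
  then show ?case unfolding green_Suc by (elim imageE) (simp add: omega_DF)
qed

lemma F'_M: "a \<in> M \<Longrightarrow> F' a \<in> M"
  using M_inv[of "F' a"] by (simp add: F_F')

text \<open>
  This is where minimality excludes conjugate points. A vertical vector of \<open>green (Suc k) a\<close> ends a
  tangent orbit whose base part vanishes at both ends. Unless it is zero, this orbit can be improved
  at its end: moving the last point by \<open>t e\<close> changes the upper bound by a term that is linear in
  \<open>t\<close>, which for small \<open>t\<close> of the appropriate sign contradicts the lower bound of \<open>upper_ge\<close>.
\<close>

lemma green_vertical:
  assumes "a \<in> M" "x \<in> green (Suc k) a" "fst x = 0"
  shows "x = 0"
proof (cases k)
  case 0
  then obtain p where p: "x = DF (F' a) (0, p)" using assms(2) by (auto simp: green_0 green_Suc vertical_def)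
  then have "p = 0" using vertical_step assms(3) by blast
  then show ?thesis using p linear_0[OF linear_DF] by (simp flip: zero_prod_def)
next
  case (Suc j)
  then obtain y where y: "y \<in> green (Suc j) (F' a)" "x = DF (F' a) y" using assms(2) green_Suc by blast
  define b where "b = F' a"
  define e where "e = snd x"
  \<comment> \<open>Upper bound minus lower bound, for the last point displaced by \<open>t *\<^sub>R e\<close>.\<close>
  have *: "0 \<le> 2 * t * (e \<bullet> e) + t\<^sup>2 * (S2 (step b) (0, e) (0, e) + S2 (step a) (e, 0) (e, 0))" for t
  proof -
    have "upper_at (F b) (t *\<^sub>R e) (fst y \<bullet> snd y + S2 (step b) (fst y, t *\<^sub>R e) (fst y, t *\<^sub>R e))"
      using upper_step'[OF upper_green[OF y(1)]] by (simp add: b_def)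
    from upper_ge[OF _ this] have "0 \<le> fst y \<bullet> snd y + S2 (step b) (fst y, t *\<^sub>R e) (fst y, t *\<^sub>R e)
         + S2 (step a) (t *\<^sub>R e, 0) (t *\<^sub>R e, 0)"
      using assms(1) by (simp add: b_def F_F')
    also have "(fst y, t *\<^sub>R e) = (fst y, fst x) + t *\<^sub>R (0, e)" using assms(3) by simp
    also have "(t *\<^sub>R e, 0) = t *\<^sub>R (e, 0)" by simp
    also have "S2 (step b) ((fst y, fst x) + t *\<^sub>R (0, e)) ((fst y, fst x) + t *\<^sub>R (0, e)) =
       S2 (step b) (fst y, fst x) (fst y, fst x) + 2 * t * S2 (step b) (fst y, fst x) (0, e)
       + t\<^sup>2 * S2 (step b) (0, e) (0, e)"
      by (simp only: S2_add S2_scale S2_sym[of _ "(0, e)" "(fst y, fst x)"]) (simp add: power2_eq_square algebra_simps)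
    also have "S2 (step b) (fst y, fst x) (fst y, fst x) = - (fst y \<bullet> snd y)"
      using S2_tangent[of b y] assms(3) y(2) by (simp add: b_def)
    also have "S2 (step b) (fst y, fst x) (0, e) = e \<bullet> e"
      using tangent[of b y "(0, e)"] y(2) by (simp add: b_def e_def)
    finally show ?thesis by (simp only: S2_scale) (simp add: power2_eq_square algebra_simps)
  qed
  define K where "K = S2 (step b) (0, e) (0, e) + S2 (step a) (e, 0) (e, 0)"
  have "e = 0"
  proof (rule ccontr)
    assume "e \<noteq> 0"
    then have pos: "e \<bullet> e > 0" by simp
    \<comment> \<open>A negative \<open>t\<close> so small that the linear term dominates.\<close>
    define t where "t = - (e \<bullet> e) / (\<bar>K\<bar> + 1)"
    have t: "t < 0" using pos by (simp add: t_def divide_neg_pos)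
    have "t * K \<ge> - (e \<bullet> e)"
    proof -
      have "\<bar>t * K\<bar> = (e \<bullet> e) * (\<bar>K\<bar> / (\<bar>K\<bar> + 1))" using pos by (simp add: t_def abs_mult)
      also have "\<dots> \<le> (e \<bullet> e) * 1" using pos by (intro mult_left_mono) auto
      finally show ?thesis by linarith
    qed
    then have "t * (2 * (e \<bullet> e) + t * K) < 0" using t pos by (intro mult_neg_pos) linarith+
    moreover have "t * (2 * (e \<bullet> e) + t * K) = 2 * t * (e \<bullet> e) + t\<^sup>2 * K"
      by (simp add: power2_eq_square algebra_simps)
    ultimately show False using *[of t] by (simp add: K_def)
  qed
  then show ?thesis using assms(3) by (simp add: e_def prod_eq_iff)
qed

lemma green_graph:
  assumes "a \<in> M"
  shows "\<exists>A. green (Suc k) a = matrix_graph A \<and> transpose A = A"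
proof -
  let ?G = "green (Suc k) a"
  have inj: "inj_on fst ?G"
  proof (rule inj_onI)
    fix x y assume "x \<in> ?G" "y \<in> ?G" "fst x = fst y"
    then have "x - y \<in> ?G" "fst (x - y) = 0" using subspace_diff[OF subspace_green] by auto
    then have "x - y = 0" by (intro green_vertical[OF assms])
    then show "x = y" by simp
  qed
  have sp: "span ?G = ?G" using subspace_green by simp
  have l: "linear (fst :: 'n plane \<Rightarrow> real ^ 'n)" by (rule linear_fst)
  obtain g where g: "range g \<subseteq> ?G" "linear g" "\<And>x. x \<in> ?G \<Longrightarrow> g (fst x) = x"
    using linear_inj_on_left_inverse[OF l, of ?G] inj unfolding sp by blast
  have "dim (fst ` ?G) = dim ?G" by (rule dim_image_eq[OF l]) (simp add: sp inj)
  then have "fst ` ?G = UNIV"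
    using linear_subspace_image[OF l subspace_green, of "Suc k" a]
    by (intro subspace_dim_equal) (auto simp: dim_green dim_UNIV)
  then have fg: "fst (g h) = h" for h using g(3) by (metis UNIV_I imageE)
  have l2: "linear (\<lambda>h. snd (g h))" using linear_compose[OF g(2) linear_snd] by (simp add: o_def)
  define A where "A = matrix (\<lambda>h. snd (g h))"
  have A: "A *v h = snd (g h)" for h unfolding A_def by (rule matrix_works) (simp add: linear_matrix_vector_mul_eq l2)
  have gA: "g h = (h, A *v h)" for h using fg A by (simp add: prod_eq_iff)
  have 1: "?G = matrix_graph A"
    using g(1,3) unfolding matrix_graph_def gA by (auto simp: image_subset_iff)
  have "h \<bullet> (A *v h') = (A *v h) \<bullet> h'" for h h'
    using green_isotropic[of "(h, A *v h)" "Suc k" a "(h', A *v h')"]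
    unfolding 1 by (auto simp: matrix_graph_def omega_def)
  then have "transpose A = A"
    by (metis dot_lmul_matrix inner_commute matrix_eq vector_eq_ldot transpose_matrix_vector)
  with 1 show ?thesis by blast
qed

text \<open>
  The function of \<open>y'\<close> on the right is quadratic on the subspace \<open>green (Suc k) a\<close>, and \<open>y\<close> is a
  critical point of it since its image lies over \<open>h\<close>. By \<open>upper_ge\<close> the quadratic part is
  nonnegative, so a critical point is a minimum.
\<close>

lemma green_minimal:
  assumes "a \<in> M" "y \<in> green (Suc k) a" "y' \<in> green (Suc k) a" and h: "h = fst (DF a y)"
  shows "fst y \<bullet> snd y + S2 (step a) (fst y, h) (fst y, h)
    \<le> fst y' \<bullet> snd y' + S2 (step a) (fst y', h) (fst y', h)"
proof -
  define d where "d = y' - y"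
  have d: "d \<in> green (Suc k) a" unfolding d_def by (rule subspace_diff[OF subspace_green assms(3,2)])
  have 1: "0 \<le> fst d \<bullet> snd d + S2 (step a) (fst d, 0) (fst d, 0)"
    by (rule upper_ge[OF assms(1) upper_green[OF d]])
  have 2: "fst y \<bullet> snd d = snd y \<bullet> fst d"
    using green_isotropic[OF assms(2) d] by (simp add: omega_def)
  have y': "fst y' = fst y + fst d" "snd y' = snd y + snd d" by (simp_all add: d_def)
  have e: "(fst y', h) = (fst y, h) + (fst d, 0)" using y' by simp
  have 3: "S2 (step a) (fst y, h) (fst d, 0) = - (snd y \<bullet> fst d)"
    using tangent[of a y "(fst d, 0)"] h by simp
  have 4: "S2 (step a) (fst y', h) (fst y', h) = S2 (step a) (fst y, h) (fst y, h)
     + 2 * S2 (step a) (fst y, h) (fst d, 0) + S2 (step a) (fst d, 0) (fst d, 0)"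
    unfolding e by (simp only: S2_add S2_sym[of _ "(fst d, 0)" "(fst y, h)"])
  have 5: "fst y' \<bullet> snd y' = fst y \<bullet> snd y + 2 * (snd y \<bullet> fst d) + fst d \<bullet> snd d"
    using 2 by (simp add: y' inner_add_left inner_add_right inner_commute)
  show ?thesis using 1 3 4 5 by linarith
qed

text \<open>
  The slope of \<open>green (Suc k) a\<close> is the minimum of a second variation over a past that is longer by
  one step, hence over more competitors. For \<open>k = 0\<close> the second subspace is the vertical, and both
  sides vanish.
\<close>

lemma green_mono:
  assumes "a \<in> M" "x \<in> green (Suc k) a" "x' \<in> green k a" "fst x = fst x'"
  shows "fst x \<bullet> snd x \<le> fst x' \<bullet> snd x'"
  using assms
proof (induction k arbitrary: a x x')
  case 0
  then show ?case by (simp add: green_0 vertical_def)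
next
  case (Suc k)
  define b where "b = F' a"
  have bM: "b \<in> M" using F'_M Suc.prems by (simp add: b_def)
  obtain y where y: "y \<in> green (Suc k) b" "x = DF b y" using Suc.prems(2) green_Suc b_def by blast
  obtain y' where y': "y' \<in> green k b" "x' = DF b y'" using Suc.prems(3) green_Suc b_def by blast
  obtain z where z: "z \<in> green (Suc k) b" "fst z = fst y'"
    using green_graph[OF bM, of k] unfolding matrix_graph_def by (metis (mono_tags, lifting) fst_conv mem_Collect_eq)
  have "fst z \<bullet> snd z \<le> fst y' \<bullet> snd y'" by (rule Suc.IH[OF bM z(1) y'(1) z(2)])
  moreover have "fst y \<bullet> snd y + S2 (step b) (fst y, fst x) (fst y, fst x)
    \<le> fst z \<bullet> snd z + S2 (step b) (fst z, fst x) (fst z, fst x)"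
    by (rule green_minimal[OF bM y(1) z(1)]) (simp add: y)
  ultimately show ?case
    using S2_tangent[of b y] S2_tangent[of b y'] y(2) y'(2) z(2) Suc.prems(4) by simp
qed

lemma green_convergent:
  assumes "a \<in> M"
  shows "\<exists>P P\<^sub>0. (\<forall>k. green (Suc k) a = matrix_graph (P k)) \<and> P \<longlonglongrightarrow> P\<^sub>0 \<and> transpose P\<^sub>0 = P\<^sub>0"
proof -
  obtain P where P: "\<And>k. green (Suc k) a = matrix_graph (P k)" "\<And>k. transpose (P k) = P k"
    using green_graph[OF assms] by metis
  have mem: "(h, P k *v h) \<in> green (Suc k) a" for k h by (auto simp: P matrix_graph_def)
  have "\<exists>B. P \<longlonglongrightarrow> B \<and> transpose B = B"
  proof (rule symmetric_decreasing_convergent[OF P(2)])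
    show "h \<bullet> (P (Suc k) *v h) \<le> h \<bullet> (P k *v h)" for k h
      using green_mono[OF assms mem mem] by simp
    show "- S2 (step a) (h, 0) (h, 0) \<le> h \<bullet> (P k *v h)" for k h
      using upper_ge[OF assms upper_green[OF mem[of h k]]] by simp
  qed
  then show ?thesis using P by blast
qed

definition lower_at :: "'n plane \<Rightarrow> real ^ 'n \<Rightarrow> real \<Rightarrow> bool" where
  "lower_at a h C \<longleftrightarrow> (\<forall>x e hs d. (\<forall>k. x k \<in> M) \<longrightarrow> x \<longlonglongrightarrow> a \<longrightarrow> e \<longlonglongrightarrow> 0 \<longrightarrow> hs \<longlonglongrightarrow> h \<longrightarrow> d > 0 \<longrightarrow>
     (\<forall>\<^sub>F k in sequentially.
        u (fst (x k)) + e k * (snd (x k) \<bullet> hs k) + (e k)\<^sup>2 * (C / 2 - d) \<le> u (fst (x k) + e k *\<^sub>R hs k)))"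

lemma lower_atD:
  assumes "lower_at a h C" "\<And>k. x k \<in> M" "x \<longlonglongrightarrow> a" "e \<longlonglongrightarrow> 0" "hs \<longlonglongrightarrow> h" "d > 0"
  shows "\<forall>\<^sub>F k in sequentially.
        u (fst (x k)) + e k * (snd (x k) \<bullet> hs k) + (e k)\<^sup>2 * (C / 2 - d) \<le> u (fst (x k) + e k *\<^sub>R hs k)"
  using assms unfolding lower_at_def by blast

text \<open>
  Let \<open>(q, p)\<close> and \<open>(q', p')\<close> be the ends of a short secant. At \<open>q' + e \<eta> = q + e (\<eta> + v)\<close> the lower
  bound based at \<open>q\<close> lies below the upper bound based at \<open>q'\<close>; at the mirrored point
  \<open>q - e \<eta> = q' - e (\<eta> + v)\<close> the same holds with the roles exchanged. In the sum of the two
  inequalities the unknown difference \<open>u q' - u q\<close> cancels, and the first-order terms combine to the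
  increment of the momentum, which is \<open>e w\<close> in the limit.
\<close>

lemma pair_inequality:
  assumes up: "upper_at a \<eta> C" and low: "lower_at a (\<eta> + v) C'"
    and vw: "(v, w) \<in> paratingent_cone M a"
  shows "- (w \<bullet> (2 *\<^sub>R \<eta> + v)) \<le> C - C'"
proof -
  obtain x x' e W where x: "\<And>k. x k \<in> M" "x \<longlonglongrightarrow> a" and x': "\<And>k. x' k \<in> M" "x' \<longlonglongrightarrow> a"
    and e: "e \<longlonglongrightarrow> 0" "\<And>k. e k \<noteq> 0"
    and W: "W \<longlonglongrightarrow> (v, w)" "\<And>k. x' k = x k + e k *\<^sub>R W k"
    using vw unfolding paratingent_cone_def by blast
  have v: "(\<lambda>k. fst (W k)) \<longlonglongrightarrow> v" and w: "(\<lambda>k. snd (W k)) \<longlonglongrightarrow> w"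
    using tendsto_fst[OF W(1)] tendsto_snd[OF W(1)] by auto
  have me: "(\<lambda>k. - e k) \<longlonglongrightarrow> 0" using tendsto_minus[OF e(1)] by simp
  have \<zeta>: "(\<lambda>k. \<eta> + fst (W k)) \<longlonglongrightarrow> \<eta> + v" by (intro tendsto_intros v)
  have main: "- (w \<bullet> (2 *\<^sub>R \<eta> + v)) \<le> C - C' + 4 * d" if d: "d > 0" for d
  proof (rule tendsto_upperbound)
    show "(\<lambda>k. - (snd (W k) \<bullet> (2 *\<^sub>R \<eta> + fst (W k)))) \<longlonglongrightarrow> - (w \<bullet> (2 *\<^sub>R \<eta> + v))"
      by (intro tendsto_intros v w)
    show "\<forall>\<^sub>F k in sequentially. - (snd (W k) \<bullet> (2 *\<^sub>R \<eta> + fst (W k))) \<le> C - C' + 4 * d"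
      using upper_atD[OF up x' e(1) tendsto_const d] lower_atD[OF low x e(1) \<zeta> d]
        upper_atD[OF up x me tendsto_const d] lower_atD[OF low x' me \<zeta> d]
    proof eventually_elim
      case (elim k)
      let ?q = "fst (x k)" and ?p = "snd (x k)" and ?q' = "fst (x' k)" and ?p' = "snd (x' k)"
      let ?v = "fst (W k)" and ?w = "snd (W k)" and ?e = "e k"
      have q: "?q' = ?q + ?e *\<^sub>R ?v" and p: "?p' = ?p + ?e *\<^sub>R ?w" by (simp_all add: W(2))
      have 1: "?q + ?e *\<^sub>R (\<eta> + ?v) = ?q' + ?e *\<^sub>R \<eta>" by (simp add: q algebra_simps)
      have 2: "?q' + (- ?e) *\<^sub>R (\<eta> + ?v) = ?q + (- ?e) *\<^sub>R \<eta>" by (simp add: q algebra_simps)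
      have "?e * (?p \<bullet> (\<eta> + ?v)) + ?e\<^sup>2 * (C' / 2 - d) + (- ?e) * (?p' \<bullet> (\<eta> + ?v)) + ?e\<^sup>2 * (C' / 2 - d)
        \<le> ?e * (?p' \<bullet> \<eta>) + ?e\<^sup>2 * (C / 2 + d) + (- ?e) * (?p \<bullet> \<eta>) + ?e\<^sup>2 * (C / 2 + d)"
        using elim unfolding 1 2 power2_minus by linarith
      then have "?e\<^sup>2 * (- (?w \<bullet> (2 *\<^sub>R \<eta> + ?v))) \<le> ?e\<^sup>2 * (C - C' + 4 * d)"
        unfolding p by (simp add: power2_eq_square inner_add_left inner_add_right field_simps)
      then show ?case using e(2)[of k] by (subst (asm) mult_le_cancel_left_pos) auto
    qed
  qed simp
  show ?thesis
  proof (rule field_le_epsilon)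
    fix d :: real assume "d > 0"
    then show "- (w \<bullet> (2 *\<^sub>R \<eta> + v)) \<le> C - C' + d" using main[of "d / 4"] by simp
  qed
qed

end

section \<open>Time reversal\<close>

definition time_reversal :: "'n::finite plane \<Rightarrow> 'n plane" where
  "time_reversal z = (fst z, - snd z)"

lemma time_reversal_simps [simp]:
  "time_reversal (time_reversal z) = z" "fst (time_reversal z) = fst z" "snd (time_reversal z) = - snd z"
  by (simp_all add: time_reversal_def)

lemma bounded_linear_time_reversal: "bounded_linear (time_reversal :: 'n::finite plane \<Rightarrow> 'n plane)"
  unfolding linear_conv_bounded_linear[symmetric] by (auto simp: linear_iff time_reversal_def)

lemmas has_derivative_time_reversal [derivative_intros] =
  bounded_linear.has_derivative[OF bounded_linear_time_reversal]

lemma bounded_linear_swap: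
  "bounded_linear (prod.swap :: 'n::finite plane \<Rightarrow> 'n plane)"
  unfolding linear_conv_bounded_linear[symmetric] by (auto simp: linear_iff)

context calibrated
begin

definition backward_green :: "nat \<Rightarrow> 'n plane \<Rightarrow> 'n plane set" where
  "backward_green k z = frechet_derivative (F' ^^ k) (at ((F ^^ k) z)) ` vertical"

text \<open>
  Conjugation with \<open>(q, p) \<mapsto> (q, - p)\<close> turns the inverse map into the map generated by \<open>S (Q, q)\<close>,
  and \<open>- u\<close> grows at most like the reversed action. Statements about images of the vertical under
  forward iteration therefore yield those about backward iteration, with upper bounds becoming lower
  bounds.
\<close>

lemma calibrated_time_reversal:
  "calibrated (\<lambda>z. time_reversal (F' (time_reversal z))) (\<lambda>z. time_reversal (F (time_reversal z)))
     (\<lambda>z w. time_reversal (DF' (time_reversal z) (time_reversal w)))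
     (\<lambda>z w. time_reversal (DF (time_reversal z) (time_reversal w)))
     (\<lambda>x. S (prod.swap x)) (\<lambda>x b. S1 (prod.swap x) (prod.swap b))
     (\<lambda>x a b. S2 (prod.swap x) (prod.swap a) (prod.swap b)) (time_reversal -` M) (\<lambda>q. - u q) c"
proof
  fix z x b :: "'n plane"
  have R: "(time_reversal has_derivative time_reversal) (at z)"
    by (rule bounded_linear_imp_has_derivative[OF bounded_linear_time_reversal])
  have W: "(prod.swap has_derivative prod.swap) (at x)"
    by (rule bounded_linear_imp_has_derivative[OF bounded_linear_swap])
  show "((\<lambda>z. time_reversal (F' (time_reversal z))) has_derivative
         (\<lambda>w. time_reversal (DF' (time_reversal z) (time_reversal w)))) (at z)"
    using has_derivative_time_reversal[OF diff_chain_at[OF R F'_deriv]] by (simp add: o_def)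
  show "((\<lambda>z. time_reversal (F (time_reversal z))) has_derivative
         (\<lambda>w. time_reversal (DF (time_reversal z) (time_reversal w)))) (at z)"
    using has_derivative_time_reversal[OF diff_chain_at[OF R F_deriv]] by (simp add: o_def)
  show "((\<lambda>x. S (prod.swap x)) has_derivative (\<lambda>b. S1 (prod.swap x) (prod.swap b))) (at x)"
    using diff_chain_at[OF W S_deriv] by (simp add: o_def)
  show "((\<lambda>x. S1 (prod.swap x) (prod.swap b)) has_derivative
          (\<lambda>a. S2 (prod.swap x) (prod.swap a) (prod.swap b))) (at x)"
    using diff_chain_at[OF W S1_deriv] by (simp add: o_def)
next
  have "continuous_on UNIV (\<lambda>y :: 'n plane \<times> 'n plane \<times> 'n plane.
      (prod.swap (fst y), prod.swap (fst (snd y)), prod.swap (snd (snd y))))"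
    unfolding prod.swap_def by (intro continuous_intros)
  from continuous_on_compose2[OF S2_cont this]
  show "continuous_on UNIV (\<lambda>(x, a, b). S2 (prod.swap x) (prod.swap a) (prod.swap b))"
    by (simp add: case_prod_unfold)
next
  fix q p Q P :: "real ^ 'n"
  have "time_reversal (F' (time_reversal (q, p))) = (Q, P) \<longleftrightarrow> F (Q, - P) = (q, - p)"
    by (metis F'_F F_F' time_reversal_def time_reversal_simps(1) fst_conv snd_conv)
  also have "\<dots> \<longleftrightarrow> (\<forall>w. S1 (Q, q) w = (- p) \<bullet> snd w - (- P) \<bullet> fst w)" by (rule gen)
  also have "\<dots> \<longleftrightarrow> (\<forall>w. S1 (prod.swap (q, Q)) (prod.swap w) = P \<bullet> snd w - p \<bullet> fst w)"
    by (auto simp: algebra_simps)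
  finally show "time_reversal (F' (time_reversal (q, p))) = (Q, P) \<longleftrightarrow>
      (\<forall>w. S1 (prod.swap (q, Q)) (prod.swap w) = P \<bullet> snd w - p \<bullet> fst w)" .
next
  fix q Q :: "real ^ 'n"
  obtain p P where "F (Q, p) = (q, P)" using connect by blast
  then have "time_reversal (F' (time_reversal (q, - P))) = (Q, - p)"
    by (metis F'_F fst_conv snd_conv time_reversal_def minus_minus)
  then show "\<exists>p P. time_reversal (F' (time_reversal (q, p))) = (Q, P)" by blast
next
  fix y y' :: "real ^ 'n"
  show "- u y \<le> - u y' + S (prod.swap (y', y)) - c" using subsolution[of y' y] by simp
next
  fix z :: "'n plane"
  let ?R = "time_reversal z"
  assume "z \<in> time_reversal -` M"
  then have "F' ?R \<in> M" using F'_M by simp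
  from calibration[OF this] show "- u (fst (time_reversal (F' (time_reversal z))))
      = - u (fst z) + S (prod.swap (fst z, fst (time_reversal (F' (time_reversal z))))) - c"
    by (simp add: F_F')
qed (use M_inv[of "F' _"] in \<open>simp_all add: F_F' F'_F S2_sym\<close>)

lemma funpow_time_reversal:
  fixes G :: "'n plane \<Rightarrow> 'n plane"
  shows "((\<lambda>z. time_reversal (G (time_reversal z))) ^^ k) z = time_reversal ((G ^^ k) (time_reversal z))"
  by (induction k) auto

lemma green_time_reversal:
  "generated_map.green (\<lambda>z. time_reversal (F' (time_reversal z))) (\<lambda>z. time_reversal (F (time_reversal z))) k z
    = time_reversal ` backward_green k (time_reversal z)"
proof -
  interpret rev: calibrated "\<lambda>z. time_reversal (F' (time_reversal z))" "\<lambda>z. time_reversal (F (time_reversal z))"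
    "\<lambda>z w. time_reversal (DF' (time_reversal z) (time_reversal w))"
    "\<lambda>z w. time_reversal (DF (time_reversal z) (time_reversal w))"
    "\<lambda>x. S (prod.swap x)" "\<lambda>x b. S1 (prod.swap x) (prod.swap b)"
    "\<lambda>x a b. S2 (prod.swap x) (prod.swap a) (prod.swap b)" "time_reversal -` M" "\<lambda>q. - u q" c
    by (rule calibrated_time_reversal)
  let ?y = "(F ^^ k) (time_reversal z)"
  obtain D where D: "(F' ^^ k has_derivative D) (at ?y)"
    using funpow_has_derivative[OF F'_deriv] by blast
  have R: "(time_reversal has_derivative time_reversal) (at (time_reversal ?y))"
    by (rule bounded_linear_imp_has_derivative[OF bounded_linear_time_reversal])
  have D': "(F' ^^ k has_derivative D) (at (time_reversal (time_reversal ?y)))" using D by simp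
  have eq: "(\<lambda>z. time_reversal (F' (time_reversal z))) ^^ k = (\<lambda>z. time_reversal ((F' ^^ k) (time_reversal z)))"
    by (rule ext) (rule funpow_time_reversal)
  have "((\<lambda>z. time_reversal (F' (time_reversal z))) ^^ k has_derivative (\<lambda>w. time_reversal (D (time_reversal w))))
      (at (time_reversal ?y))"
    unfolding eq using has_derivative_time_reversal[OF diff_chain_at[OF R D']] by (simp add: o_def)
  note fd = frechet_derivative_at[OF this, symmetric] frechet_derivative_at[OF D, symmetric]
  have "time_reversal x \<in> vertical" if "x \<in> vertical" for x :: "'n plane"
    using that by (simp add: vertical_def)
  then have "time_reversal ` vertical = (vertical :: 'n plane set)"
    by (metis (no_types, lifting) image_subset_iff subsetI subset_antisym image_eqI time_reversal_simps(1))
  then have "(\<lambda>w. time_reversal (D (time_reversal w))) ` vertical = time_reversal ` D ` vertical"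
    by (metis image_image)
  then show ?thesis
    unfolding rev.green_def backward_green_def funpow_time_reversal[of _ F] fd .
qed

lemma lower_at_time_reversal:
  assumes "calibrated.upper_at (time_reversal -` M) (\<lambda>q. - u q) (time_reversal a) h C"
  shows "lower_at a h (- C)"
proof -
  interpret rev: calibrated "\<lambda>z. time_reversal (F' (time_reversal z))" "\<lambda>z. time_reversal (F (time_reversal z))"
    "\<lambda>z w. time_reversal (DF' (time_reversal z) (time_reversal w))"
    "\<lambda>z w. time_reversal (DF (time_reversal z) (time_reversal w))"
    "\<lambda>x. S (prod.swap x)" "\<lambda>x b. S1 (prod.swap x) (prod.swap b)"
    "\<lambda>x a b. S2 (prod.swap x) (prod.swap a) (prod.swap b)" "time_reversal -` M" "\<lambda>q. - u q" c
    by (rule calibrated_time_reversal)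
  show ?thesis
    unfolding lower_at_def
  proof (intro allI impI)
    fix x :: "nat \<Rightarrow> 'n plane" and e :: "nat \<Rightarrow> real" and hs :: "nat \<Rightarrow> real ^ 'n" and d :: real
    assume x: "\<forall>k. x k \<in> M" "x \<longlonglongrightarrow> a" and e: "e \<longlonglongrightarrow> 0" and hs: "hs \<longlonglongrightarrow> h" and d: "d > 0"
    have "(\<lambda>k. time_reversal (x k)) \<longlonglongrightarrow> time_reversal a"
      by (rule bounded_linear.tendsto[OF bounded_linear_time_reversal x(2)])
    from rev.upper_atD[OF assms _ this e hs d] x(1)
    show "\<forall>\<^sub>F k in sequentially. u (fst (x k)) + e k * (snd (x k) \<bullet> hs k) + (e k)\<^sup>2 * (- C / 2 - d)
        \<le> u (fst (x k) + e k *\<^sub>R hs k)"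
      by (simp add: algebra_simps)
  qed
qed

text \<open>
  The slopes \<open>P k\<close> bound the Hessian of \<open>u\<close> from above, the slopes \<open>N k\<close> bound it from below, and
  \<open>pair_inequality\<close> holds for every pair of such bounds. As \<open>P k\<close> decreases and \<open>N k\<close> increases with
  \<open>k\<close>, the inequality for the two limits is the strongest one.
\<close>

theorem green_bundles:
  assumes a: "a \<in> M"
  obtains P P\<^sub>0 N N\<^sub>0 where
    "\<forall>k. green (Suc k) a = matrix_graph (P k)" "P \<longlonglongrightarrow> P\<^sub>0" "transpose P\<^sub>0 = P\<^sub>0"
    "\<forall>k. backward_green (Suc k) a = matrix_graph (N k)" "N \<longlonglongrightarrow> N\<^sub>0" "transpose N\<^sub>0 = N\<^sub>0"
    "\<forall>v w \<eta>. (v, w) \<in> paratingent_cone M a \<longrightarrow>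
      - (w \<bullet> (2 *\<^sub>R \<eta> + v)) \<le> \<eta> \<bullet> (P\<^sub>0 *v \<eta>) - (\<eta> + v) \<bullet> (N\<^sub>0 *v (\<eta> + v))"
proof -
  interpret rev: calibrated "\<lambda>z. time_reversal (F' (time_reversal z))" "\<lambda>z. time_reversal (F (time_reversal z))"
    "\<lambda>z w. time_reversal (DF' (time_reversal z) (time_reversal w))"
    "\<lambda>z w. time_reversal (DF (time_reversal z) (time_reversal w))"
    "\<lambda>x. S (prod.swap x)" "\<lambda>x b. S1 (prod.swap x) (prod.swap b)"
    "\<lambda>x a b. S2 (prod.swap x) (prod.swap a) (prod.swap b)" "time_reversal -` M" "\<lambda>q. - u q" c
    by (rule calibrated_time_reversal)
  obtain P P\<^sub>0 where P: "\<And>k. green (Suc k) a = matrix_graph (P k)" "P \<longlonglongrightarrow> P\<^sub>0" "transpose P\<^sub>0 = P\<^sub>0"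
    using green_convergent[OF a] by blast
  have Ra: "time_reversal a \<in> time_reversal -` M" using a by simp
  obtain Q Q\<^sub>0 where Q: "\<And>k. rev.green (Suc k) (time_reversal a) = matrix_graph (Q k)" "Q \<longlonglongrightarrow> Q\<^sub>0" "transpose Q\<^sub>0 = Q\<^sub>0"
    using rev.green_convergent[OF Ra] by blast
  define N where "N k = - Q k" for k
  have N: "N \<longlonglongrightarrow> - Q\<^sub>0" unfolding N_def[abs_def] by (intro tendsto_intros Q)
  have mv: "(- A) *v h = - (A *v h)" for A :: "real ^ 'n ^ 'n" and h
    by (simp add: matrix_vector_mult_def vec_eq_iff sum_negf)
  have backward_N: "backward_green (Suc k) a = matrix_graph (N k)" for k
  proof -
    have "time_reversal ` backward_green (Suc k) a = matrix_graph (Q k)"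
      using green_time_reversal[of "Suc k" "time_reversal a"] Q(1)[of k] by simp
    then have "backward_green (Suc k) a = time_reversal ` matrix_graph (Q k)"
      by (metis (no_types, lifting) image_image image_ident image_cong time_reversal_simps(1))
    also have "\<dots> = matrix_graph (N k)"
      by (force simp: matrix_graph_def N_def mv time_reversal_def)
    finally show ?thesis .
  qed
  have tr: "transpose (- Q\<^sub>0) = - Q\<^sub>0" using Q(3) by (simp add: transpose_def vec_eq_iff)
  have main: "- (w \<bullet> (2 *\<^sub>R \<eta> + v)) \<le> \<eta> \<bullet> (P\<^sub>0 *v \<eta>) - (\<eta> + v) \<bullet> (- Q\<^sub>0 *v (\<eta> + v))"
    if vw: "(v, w) \<in> paratingent_cone M a" for v w \<eta>
  proof (rule tendsto_lowerbound)
    show "(\<lambda>k. \<eta> \<bullet> (P k *v \<eta>) - (\<eta> + v) \<bullet> (N k *v (\<eta> + v))) \<longlonglongrightarrow>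
        \<eta> \<bullet> (P\<^sub>0 *v \<eta>) - (\<eta> + v) \<bullet> (- Q\<^sub>0 *v (\<eta> + v))"
      by (intro tendsto_diff tendsto_inner_matrix_vector P N tendsto_const)
    show "\<forall>\<^sub>F k in sequentially. - (w \<bullet> (2 *\<^sub>R \<eta> + v)) \<le> \<eta> \<bullet> (P k *v \<eta>) - (\<eta> + v) \<bullet> (N k *v (\<eta> + v))"
    proof (intro always_eventually allI)
      fix k
      have "(\<eta>, P k *v \<eta>) \<in> green (Suc k) a" by (auto simp: P matrix_graph_def)
      from upper_green[OF this] have up: "upper_at a \<eta> (\<eta> \<bullet> (P k *v \<eta>))" by simp
      have "(\<eta> + v, Q k *v (\<eta> + v)) \<in> rev.green (Suc k) (time_reversal a)" by (auto simp: Q matrix_graph_def)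
      from lower_at_time_reversal[OF rev.upper_green[OF this]]
      have low: "lower_at a (\<eta> + v) ((\<eta> + v) \<bullet> (N k *v (\<eta> + v)))" by (simp add: N_def mv)
      show "- (w \<bullet> (2 *\<^sub>R \<eta> + v)) \<le> \<eta> \<bullet> (P k *v \<eta>) - (\<eta> + v) \<bullet> (N k *v (\<eta> + v))"
        by (rule pair_inequality[OF up low vw])
    qed
  qed simp
  show ?thesis
  proof (rule that)
    show "\<forall>k. green (Suc k) a = matrix_graph (P k)" using P(1) by blast
    show "\<forall>k. backward_green (Suc k) a = matrix_graph (N k)" using backward_N by blast
    show "\<forall>v w \<eta>. (v, w) \<in> paratingent_cone M a \<longrightarrow>
        - (w \<bullet> (2 *\<^sub>R \<eta> + v)) \<le> \<eta> \<bullet> (P\<^sub>0 *v \<eta>) - (\<eta> + v) \<bullet> (- Q\<^sub>0 *v (\<eta> + v))"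
      using main by blast
  qed (fact P(2) P(3) N tr)+
qed

end

section \<open>The annulus and its covering map\<close>

lemma abs_torus_eq_iff: "abs_torus x = abs_torus y \<longleftrightarrow> x - y \<in> int_vecs"
  by (rule torus.abs_eq_iff)

lemma cover_eq_iff: "cover z = cover z' \<longleftrightarrow> fst z - fst z' \<in> int_vecs \<and> snd z = snd z'"
  by (simp add: cover_def abs_torus_eq_iff)

lemma int_vecs_minus: "k \<in> int_vecs \<Longrightarrow> - k \<in> int_vecs"
  by (simp add: int_vecs_def)

lemma surj_abs_torus: "\<exists>q. t = abs_torus q"
  by (induction t rule: torus.abs_induct) blast

lemma surj_cover: "\<exists>z. cover z = x"
proof -
  obtain q where "fst x = abs_torus q" using surj_abs_torus by blast
  then have "cover (q, snd x) = x" by (simp add: cover_def prod_eq_iff)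
  then show ?thesis ..
qed

lemma continuous_cover: "continuous_on UNIV (cover :: 'a::finite plane \<Rightarrow> 'a annulus)"
proof -
  have "continuous_on UNIV (abs_torus :: real ^ 'a \<Rightarrow> 'a torus)"
    by (auto simp: continuous_on_open_vimage open_torus_def)
  then have "continuous_on UNIV (\<lambda>z::'a plane. abs_torus (fst z))"
    by (rule continuous_on_compose2) (auto intro: continuous_intros)
  then show ?thesis unfolding cover_def by (intro continuous_intros)
qed

lemma open_abs_torus:
  assumes "open A"
  shows "open (abs_torus ` A)"
proof -
  have "abs_torus -` abs_torus ` A = (\<Union>k\<in>int_vecs. (+) k ` A)"
  proof (intro set_eqI iffI)
    fix x assume "x \<in> abs_torus -` abs_torus ` A"
    then obtain y where "y \<in> A" "x - y \<in> int_vecs" by (auto simp: abs_torus_eq_iff)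
    then show "x \<in> (\<Union>k\<in>int_vecs. (+) k ` A)" by (intro UN_I[of "x - y"]) auto
  next
    fix x assume "x \<in> (\<Union>k\<in>int_vecs. (+) k ` A)"
    then obtain k y where "k \<in> int_vecs" "y \<in> A" "x = k + y" by auto
    then have "abs_torus x = abs_torus y" by (simp add: abs_torus_eq_iff)
    then show "x \<in> abs_torus -` abs_torus ` A" using \<open>y \<in> A\<close> by auto
  qed
  then show ?thesis using assms by (auto simp: open_torus_def intro: open_translation)
qed

lemma open_cover:
  assumes "open U"
  shows "open (cover ` U)"
proof (subst open_subopen, intro ballI)
  fix x assume "x \<in> cover ` U"
  then obtain z where z: "z \<in> U" "x = cover z" by blast
  obtain A B where AB: "open A" "open B" "z \<in> A \<times> B" "A \<times> B \<subseteq> U"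
    using open_prod_elim[OF assms z(1)] by blast
  have "cover ` (A \<times> B) = abs_torus ` A \<times> B" by (force simp: cover_def)
  moreover have "open (abs_torus ` A \<times> B)" by (intro open_Times open_abs_torus AB)
  ultimately have "open (cover ` (A \<times> B))" by simp
  then show "\<exists>T. open T \<and> x \<in> T \<and> T \<subseteq> cover ` U"
    using AB z by blast
qed

text \<open>
  The covering map is open and onto, hence a quotient map.
\<close>

lemma continuous_on_annulus:
  assumes "continuous_on UNIV (\<lambda>z. g (cover z))"
  shows "continuous_on UNIV g"
proof -
  have "g -` V = cover ` ((\<lambda>z. g (cover z)) -` V)" for V
  proof (intro set_eqI iffI)
    fix x assume "x \<in> g -` V"
    moreover obtain z where "cover z = x" using surj_cover by blast
    ultimately show "x \<in> cover ` ((\<lambda>z. g (cover z)) -` V)" by auto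
  qed auto
  moreover have "open ((\<lambda>z. g (cover z)) -` V)" if "open V" for V
    by (rule open_vimage[OF that assms])
  ultimately have "open (g -` V)" if "open V" for V using open_cover that by metis
  then show ?thesis by (simp add: continuous_on_open_vimage)
qed

text \<open>
  Distinct values of a coordinate are at least \<open>1\<close> apart.
\<close>

lemma continuous_int_vecs_constant:
  fixes j :: "'a::real_normed_vector \<Rightarrow> real ^ 'n"
  assumes cont: "continuous_on UNIV j" and int: "\<And>x. j x \<in> int_vecs"
  shows "j x = j y"
proof -
  have "(\<lambda>x. j x $ i) constant_on UNIV" for i
  proof (rule continuous_discrete_range_constant)
    show "continuous_on UNIV (\<lambda>x. j x $ i)" by (intro continuous_intros cont)
    fix x
    have "1 \<le> \<bar>j y $ i - j x $ i\<bar>" if "j y $ i \<noteq> j x $ i" for y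
    proof -
      have "j y $ i - j x $ i \<in> \<int>" using int by (auto simp: int_vecs_def)
      then show ?thesis using that by (intro Ints_nonzero_abs_ge1) auto
    qed
    then show "\<exists>e>0. \<forall>y. y \<in> UNIV \<and> j y $ i \<noteq> j x $ i \<longrightarrow> e \<le> norm (j y $ i - j x $ i)"
      by (intro exI[of _ 1]) auto
  qed (rule convex_connected[OF convex_UNIV])
  then show ?thesis unfolding constant_on_def vec_eq_iff by (metis UNIV_I)
qed

lemma C1_map_differentiable:
  fixes g :: "'a::real_normed_vector \<Rightarrow> 'b::real_normed_vector"
  assumes "C1_map g"
  obtains D where "\<And>x. (g has_derivative D x) (at x)"
proof -
  obtain g' :: "'a \<Rightarrow> 'a \<Rightarrow>\<^sub>L 'b" where "\<forall>x. (g has_derivative blinfun_apply (g' x)) (at x)"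
    using assms unfolding C1_map_def by blast
  then show ?thesis using that[of "\<lambda>x. blinfun_apply (g' x)"] by blast
qed

lemma C1_map_continuous:
  fixes g :: "'a::real_normed_vector \<Rightarrow> 'b::real_normed_vector"
  assumes "C1_map g"
  shows "continuous_on UNIV g"
proof -
  obtain D where "\<And>x. (g has_derivative D x) (at x)" using C1_map_differentiable[OF assms] by blast
  then show ?thesis by (intro continuous_at_imp_continuous_on ballI has_derivative_continuous) blast
qed

lemma lift_composition_translation:
  assumes cont: "continuous_on UNIV H" and lift: "\<And>z :: 'n::finite plane. cover (H z) = cover z"
  shows "\<exists>k\<in>int_vecs. \<forall>z. H z = z + (k, 0)"
proof -
  define j where "j z = fst (H z) - fst z" for z
  have "continuous_on UNIV j" unfolding j_def[abs_def] by (intro continuous_intros cont)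
  moreover have int: "j z \<in> int_vecs" for z using lift[of z] by (simp add: cover_eq_iff j_def)
  ultimately have "j z = j 0" for z by (rule continuous_int_vecs_constant)
  moreover have "fst (H z) = fst z + j z" for z by (simp add: j_def)
  ultimately have "fst (H z) = fst z + j 0" for z by metis
  then have "H z = z + (j 0, 0)" for z using lift[of z, unfolded cover_eq_iff] by (simp add: prod_eq_iff)
  then show ?thesis using int by blast
qed

text \<open>
  A lift of the inverse is an inverse of \<open>F\<close> up to an integer translation on either side.
\<close>

lemma lift_bijective:
  fixes f :: "'n::finite annulus \<Rightarrow> 'n annulus"
  assumes f: "bij f" and F: "C1_lift f F" and G: "C1_lift (inv f) G"
  shows "bij F" and "\<exists>D. \<forall>z. (inv F has_derivative D z) (at z)"
proof -
  have cF: "continuous_on UNIV F" and cG: "continuous_on UNIV G"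
    using F G C1_map_continuous by (auto simp: C1_lift_def)
  have "continuous_on UNIV (\<lambda>z. F (G z))" "continuous_on UNIV (\<lambda>z. G (F z))"
    using cF cG by (auto intro: continuous_on_compose2)
  moreover have "cover (F (G z)) = cover z" "cover (G (F z)) = cover z" for z
    using F G surj_f_inv_f[OF bij_is_surj[OF f]] inv_f_f[OF bij_is_inj[OF f]]
    unfolding C1_lift_def by presburger+
  ultimately obtain k l where FG: "\<And>z. F (G z) = z + (k, 0)" and GF: "\<And>z. G (F z) = z + (l, 0)"
    using lift_composition_translation[of "\<lambda>z. F (G z)"] lift_composition_translation[of "\<lambda>z. G (F z)"] by blast
  have FG': "F (G (z - (k, 0))) = z" for z using FG[of "z - (k, 0)"] by simp
  have "inj F"
  proof (rule injI)
    fix x y assume "F x = F y"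
    then have "G (F x) = G (F y)" by simp
    then show "x = y" unfolding GF by simp
  qed
  moreover have "surj F" using FG' by (rule surjI)
  ultimately show "bij F" by (rule bijI)
  have "inv F = (\<lambda>z. G (z - (k, 0)))"
    by (rule ext, rule inv_f_eq[OF \<open>inj F\<close>]) (rule FG')
  moreover obtain D where D: "\<And>x. (G has_derivative D x) (at x)"
    using G C1_map_differentiable unfolding C1_lift_def by blast
  have "((\<lambda>z. G (z - (k, 0))) has_derivative D (z - (k, 0))) (at z)" for z
  proof -
    have "((\<lambda>z. z - (k, 0)) has_derivative (\<lambda>h. h)) (at z)" by (auto intro!: derivative_eq_intros)
    from diff_chain_at[OF this D] show ?thesis by (simp add: o_def)
  qed
  ultimately have "(inv F has_derivative D (z - (k, 0))) (at z)" for z by metis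
  then show "\<exists>D. \<forall>z. (inv F has_derivative D z) (at z)" by (intro exI[of _ "\<lambda>z. D (z - (k, 0))"] allI)
qed

text \<open>
  The vector \<open>j\<close> describes the action of \<open>f\<close> on the fundamental group: the displacement of \<open>F\<close> under
  the translation is continuous with integer values, hence constant.
\<close>

lemma lift_translation:
  fixes f :: "'n::finite annulus \<Rightarrow> 'n annulus"
  assumes F: "C1_lift f F" and k: "k \<in> int_vecs"
  shows "\<exists>j\<in>int_vecs. \<forall>z. F (z + (k, 0)) = F z + (j, 0)"
proof -
  have cF: "continuous_on UNIV F" using F C1_map_continuous by (auto simp: C1_lift_def)
  define j where "j z = fst (F (z + (k, 0))) - fst (F z)" for z
  have "continuous_on UNIV (\<lambda>z. F (z + (k, 0)))"
    by (rule continuous_on_compose2[OF cF]) (auto intro!: continuous_intros)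
  then have "continuous_on UNIV j" unfolding j_def[abs_def] by (intro continuous_intros cF)
  moreover have "cover (z + (k, 0)) = cover z" for z using k by (simp add: cover_eq_iff)
  then have c: "cover (F (z + (k, 0))) = cover (F z)" for z using F unfolding C1_lift_def by metis
  then have int: "j z \<in> int_vecs" for z by (simp add: cover_eq_iff j_def)
  ultimately have "j z = j 0" for z by (rule continuous_int_vecs_constant)
  moreover have "fst (F (z + (k, 0))) = fst (F z) + j z" for z by (simp add: j_def)
  ultimately have "fst (F (z + (k, 0))) = fst (F z) + j 0" for z by metis
  then have "F (z + (k, 0)) = F z + (j 0, 0)" for z using c[of z, unfolded cover_eq_iff] by (simp add: prod_eq_iff)
  then show ?thesis using int by blast
qed

section \<open>Calibration of strongly minimizing measures\<close>

text \<open>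
  The complement of the support is a union of open null sets. Pulled back to the plane, which is
  second countable, this union has a countable subcover.
\<close>

lemma AE_support:
  fixes \<mu> :: "'n::finite annulus measure"
  assumes sets: "sets \<mu> = sets borel"
  shows "AE x in \<mu>. x \<in> support \<mu>"
proof -
  define \<U> where "\<U> = {U. open U \<and> emeasure \<mu> U = 0}"
  have "open W" if "W \<in> (\<lambda>U. cover -` U) ` \<U>" for W
    using that continuous_cover by (auto simp: \<U>_def continuous_on_open_vimage)
  then obtain \<W> where \<W>: "\<W> \<subseteq> (\<lambda>U. cover -` U) ` \<U>" "countable \<W>" "\<Union>\<W> = \<Union>((\<lambda>U. cover -` U) ` \<U>)"
    using Lindelof by blast
  have "cover ` W \<in> null_sets \<mu>" if W: "W \<in> \<W>" for W
  proof -
    obtain U where U: "U \<in> \<U>" "W = cover -` U" using W \<W>(1) by auto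
    have "cover ` W = U" unfolding U(2)
    proof (intro set_eqI iffI)
      fix x assume "x \<in> U"
      moreover obtain z where "cover z = x" using surj_cover by blast
      ultimately show "x \<in> cover ` cover -` U" by blast
    qed auto
    then show ?thesis using U(1) sets by (auto simp: \<U>_def null_sets_def)
  qed
  then have null: "(\<Union>W\<in>\<W>. cover ` W) \<in> null_sets \<mu>" using \<W>(2) by (intro null_sets_UN') auto
  show ?thesis
  proof (rule AE_I'[OF null], rule subsetI)
    fix x assume "x \<in> {x \<in> space \<mu>. x \<notin> support \<mu>}"
    then obtain U where U: "U \<in> \<U>" "x \<in> U" by (auto simp: support_def \<U>_def)
    obtain z where z: "cover z = x" using surj_cover by blast
    then have "z \<in> \<Union>\<W>" using U \<W>(3) by auto
    then show "x \<in> (\<Union>W\<in>\<W>. cover ` W)" using z by blast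
  qed
qed

lemma support_invariant:
  fixes f :: "'a::topological_space \<Rightarrow> 'a"
  assumes sets: "sets \<mu> = sets borel" and inv: "distr \<mu> borel f = \<mu>" and f: "bij f"
    and cont: "continuous_on UNIV f" "continuous_on UNIV (inv f)"
  shows "f x \<in> support \<mu> \<longleftrightarrow> x \<in> support \<mu>"
proof -
  have sp: "space \<mu> = UNIV" using sets_eq_imp_space_eq[OF sets] by simp
  have meas: "f \<in> measurable \<mu> borel"
    using borel_measurable_continuous_onI[OF cont(1)] measurable_cong_sets[OF sets refl] by blast
  have em: "emeasure \<mu> (f -` U) = emeasure \<mu> U" if "open U" for U
    using emeasure_distr[OF meas borel_open[OF that]] by (simp add: inv sp)
  show ?thesis
  proof
    assume *: "f x \<in> support \<mu>"
    show "x \<in> support \<mu>" unfolding support_def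
    proof (intro CollectI allI impI)
      fix U assume U: "open U" "x \<in> U"
      have im: "inv f -` U = f ` U" 
        using bij_vimage_eq_inv_image[OF bij_imp_bij_inv[OF f], of U] inv_inv_eq[OF f] by simp
      have "open (f ` U)" using open_vimage[OF U(1) cont(2)] unfolding im .
      moreover have "f x \<in> f ` U" using U by blast
      ultimately have "0 < emeasure \<mu> (f ` U)" using * unfolding support_def by blast
      then show "0 < emeasure \<mu> U"
        using em[OF \<open>open (f ` U)\<close>] inj_vimage_image_eq[OF bij_is_inj[OF f], of U] by simp
    qed
  next
    assume *: "x \<in> support \<mu>"
    show "f x \<in> support \<mu>" unfolding support_def
    proof (intro CollectI allI impI)
      fix U assume U: "open U" "f x \<in> U"
      have "open (f -` U)" by (rule open_vimage[OF U(1) cont(1)])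
      then have "0 < emeasure \<mu> (f -` U)" using * U(2) unfolding support_def by blast
      then show "0 < emeasure \<mu> U" using em[OF U(1)] by simp
    qed
  qed
qed

text \<open>
  Integrating a sum along an orbit of length \<open>n\<close> gives \<open>n\<close> times the integral of \<open>g\<close> because the
  measure is invariant. If all these sums stay below one constant, the integral vanishes, and a
  continuous nonnegative function with vanishing integral is zero on the support.
\<close>

lemma bounded_sums_zero_on_support:
  fixes f :: "'n::finite annulus \<Rightarrow> 'n annulus" and g :: "'n annulus \<Rightarrow> real"
  assumes sets: "sets \<mu> = sets borel" and inv: "distr \<mu> borel f = \<mu>" and prob: "prob_space \<mu>"
    and f: "continuous_on UNIV f" and g: "continuous_on UNIV g" "\<And>x. 0 \<le> g x"
    and bound: "\<And>x n. x \<in> support \<mu> \<Longrightarrow> (\<Sum>i<n. g ((f ^^ i) x)) \<le> C"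
    and x: "x \<in> support \<mu>"
  shows "g x = 0"
proof -
  have sp: "space \<mu> = UNIV" using sets_eq_imp_space_eq[OF sets] by simp
  have meas: "h \<in> borel_measurable \<mu>" if "h \<in> borel_measurable borel" for h :: "'n annulus \<Rightarrow> ennreal"
    using that measurable_cong_sets[OF sets refl] by blast
  have fm: "f \<in> measurable \<mu> borel"
    using borel_measurable_continuous_onI[OF f] measurable_cong_sets[OF sets refl] by blast
  have cont: "continuous_on UNIV (\<lambda>x. g ((f ^^ i) x))" for i
  proof (induction i)
    case (Suc i)
    have "continuous_on UNIV (\<lambda>x. g ((f ^^ i) (f x)))"
      by (rule continuous_on_compose2[OF Suc f]) auto
    then show ?case by (simp add: funpow_swap1)
  qed (use g in simp)
  have gm: "(\<lambda>x. ennreal (g ((f ^^ i) x))) \<in> borel_measurable borel" for i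
    using borel_measurable_continuous_onI[OF cont] by (intro measurable_compose[OF _ measurable_ennreal])
  define I where "I = (\<integral>\<^sup>+ x. ennreal (g x) \<partial>\<mu>)"
  have I: "(\<integral>\<^sup>+ x. ennreal (g ((f ^^ i) x)) \<partial>\<mu>) = I" for i
  proof (induction i)
    case (Suc i)
    have "(\<integral>\<^sup>+ x. ennreal (g ((f ^^ i) x)) \<partial>distr \<mu> borel f) = (\<integral>\<^sup>+ x. ennreal (g ((f ^^ i) (f x))) \<partial>\<mu>)"
      by (rule nn_integral_distr[OF fm]) (use gm in simp)
    then show ?case using Suc inv by (simp add: funpow_swap1)
  qed (simp add: I_def)
  have le: "of_nat n * I \<le> ennreal C" for n
  proof -
    have "of_nat n * I = (\<Sum>i<n. (\<integral>\<^sup>+ x. ennreal (g ((f ^^ i) x)) \<partial>\<mu>))" by (simp add: I)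
    also have "\<dots> = (\<integral>\<^sup>+ x. (\<Sum>i<n. ennreal (g ((f ^^ i) x))) \<partial>\<mu>)"
      using gm meas by (intro nn_integral_sum[symmetric]) blast
    also have "\<dots> \<le> (\<integral>\<^sup>+ x. ennreal C \<partial>\<mu>)"
    proof (rule nn_integral_mono_AE)
      show "AE x in \<mu>. (\<Sum>i<n. ennreal (g ((f ^^ i) x))) \<le> ennreal C"
        using AE_support[OF sets]
      proof (rule AE_mp, intro AE_I2 impI)
        fix x assume "x \<in> support \<mu>"
        then show "(\<Sum>i<n. ennreal (g ((f ^^ i) x))) \<le> ennreal C"
          using bound g(2) by (simp add: sum_ennreal ennreal_leI)
      qed
    qed
    also have "\<dots> = ennreal C" using prob_space.emeasure_space_1[OF prob] by simp
    finally show ?thesis .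
  qed
  have "I < \<infinity>" using le[of 1] ennreal_less_top le_less_trans by fastforce
  then obtain r where r: "I = ennreal r" "r \<ge> 0" by (cases I) auto
  have C: "C \<ge> 0" using bound[OF x, of 0] by simp
  have "real n * r \<le> C" for n
  proof -
    have "ennreal (real n * r) \<le> ennreal C"
      using le[of n] r by (simp add: ennreal_mult ennreal_of_nat_eq_real_of_nat)
    then show ?thesis using C by (simp add: ennreal_le_iff)
  qed
  then have "r = 0" using r(2) ex_less_of_nat_mult[of r C] by (cases "r = 0") (auto simp: not_less[symmetric])
  then have I0: "I = 0" using r by simp
  have "AE x in \<mu>. ennreal (g x) = 0"
    using nn_integral_0_iff_AE[OF meas[OF gm[of 0]]] I0 by (simp add: I_def)
  then have ae: "AE x in \<mu>. x \<notin> {x. g x > 0}" by (rule AE_mp) (auto simp: ennreal_eq_0_iff)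
  define U where "U = {x. g x > 0}"
  have oU: "open U"
  proof -
    have "U = g -` {0<..}" by (auto simp: U_def)
    then show ?thesis using open_vimage[OF open_greaterThan g(1)] by simp
  qed
  then have "U \<in> sets \<mu>" using sets by simp
  then have "emeasure \<mu> U = 0" using AE_iff_measurable[of U \<mu> "\<lambda>x. x \<notin> U"] ae sp by (auto simp: U_def)
  then have "x \<notin> U" using x oU by (auto simp: support_def)
  then show ?thesis using g(2)[of x] by (simp add: U_def)
qed

lemma int_vecs_cube:
  fixes v :: "real ^ 'n"
  shows "\<exists>k\<in>int_vecs. v + k \<in> cbox 0 1"
proof -
  define k :: "real ^ 'n" where "k = (\<chi> i. - of_int \<lfloor>v $ i\<rfloor>)"
  have "k \<in> int_vecs" by (simp add: k_def int_vecs_def)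
  moreover have "v + k \<in> cbox 0 1"
  proof -
    have "0 \<le> v $ i + - of_int \<lfloor>v $ i\<rfloor> \<and> v $ i + - of_int \<lfloor>v $ i\<rfloor> \<le> 1" for i
      using of_int_floor_le[of "v $ i"] real_of_int_floor_add_one_ge[of "v $ i"] by linarith
    then show ?thesis unfolding k_def mem_box_cart by simp
  qed
  ultimately show ?thesis by blast
qed

lemma periodic_bounded:
  assumes "continuous_on UNIV u" "int_periodic u"
  obtains B where "\<And>x. \<bar>u x\<bar> \<le> B"
proof -
  have "compact (u ` cbox 0 1)"
    using assms(1) by (intro compact_continuous_image compact_cbox) (auto intro: continuous_on_subset)
  then obtain B where B: "\<And>y. y \<in> u ` cbox 0 1 \<Longrightarrow> norm y \<le> B"
    using compact_imp_bounded bounded_iff by metis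
  have "\<bar>u x\<bar> \<le> B" for x
  proof -
    obtain k where k: "k \<in> int_vecs" "x + k \<in> cbox 0 1" using int_vecs_cube by blast
    then have "u x = u (x + k)" using assms(2) by (simp add: int_periodic_def)
    then show ?thesis using B k(2) by force
  qed
  then show ?thesis using that by blast
qed

lemma action_Suc:
  "action S c x 0 (int (Suc n)) = action S c x 0 (int n) + (S (x (int n), x (int (Suc n))) - c)"
proof -
  have "{0 + 1..int (Suc n)} = insert (int (Suc n)) {0 + 1..int n}" by auto
  then show ?thesis by (simp add: action_def)
qed

text \<open>
  A strongly minimizing segment may be compared with a path having any number of steps and ends that
  agree with its own modulo \<open>int_vecs\<close>. A single step between representatives in the unit cube
  already gives a bound independent of the length of the segment.
\<close>

lemma strongly_minimizing_action_bound:
  fixes S :: "'n::finite plane \<Rightarrow> real"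
  assumes S: "continuous_on UNIV S"
  obtains K where "\<And>x n. strongly_minimizing S c x \<Longrightarrow> n > 0 \<Longrightarrow> action S c x 0 (int n) \<le> K"
proof -
  have "compact (S ` (cbox 0 1 \<times> cbox 0 1))"
    using S by (intro compact_continuous_image compact_Times compact_cbox) (auto intro: continuous_on_subset)
  then obtain K where K: "\<And>y. y \<in> S ` (cbox 0 1 \<times> cbox 0 1) \<Longrightarrow> norm y \<le> K"
    using compact_imp_bounded bounded_iff by metis
  have "action S c x 0 (int n) \<le> K - c" if x: "strongly_minimizing S c x" and n: "n > 0" for x n
  proof -
    obtain k where k: "k \<in> int_vecs" "x 0 + k \<in> cbox 0 1" using int_vecs_cube by blast
    obtain l where l: "l \<in> int_vecs" "x (int n) + l \<in> cbox 0 1" using int_vecs_cube by blast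
    define y where "y i = (if i = 0 then x 0 + k else x (int n) + l)" for i :: int
    have "action S c x 0 (int n) \<le> action S c y 0 1"
    proof -
      have "(0::int) < int n" "(0::int) < 1" "y 0 - x 0 \<in> int_vecs" "y 1 - x (int n) \<in> int_vecs"
        using n k l by (auto simp: y_def)
      then show ?thesis using x unfolding strongly_minimizing_def by blast
    qed
    also have "\<dots> = S (x 0 + k, x (int n) + l) - c" by (simp add: action_def y_def)
    also have "\<dots> \<le> K - c" using K[of "S (x 0 + k, x (int n) + l)"] k l by auto
    finally show ?thesis .
  qed
  then show ?thesis using that by blast
qed

lemma linear_functional_axis:
  fixes L :: "real ^ 'n \<Rightarrow> real"
  assumes "linear L"
  shows "(\<chi> i. L (axis i 1)) \<bullet> h = L h"
proof -
  have "L h = L (\<Sum>i\<in>UNIV. h $ i *\<^sub>R axis i 1)"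
    using basis_expansion[of h] by (simp add: scalar_mult_eq_scaleR)
  also have "\<dots> = (\<Sum>i\<in>UNIV. h $ i * L (axis i 1))"
    by (simp add: linear_sum[OF assms] linear_scale[OF assms])
  finally show ?thesis by (simp add: inner_vec_def mult.commute)
qed

text \<open>
  Passage from gradients and Frechet derivatives in coordinates to the setting of \<open>generated_map\<close>.
\<close>

lemma generating_function_derivatives:
  fixes F :: "'n::finite plane \<Rightarrow> 'n plane"
  assumes "generating_function F S" and F: "bij F"
    and F_deriv: "\<And>z. (F has_derivative DF z) (at z)" and F'_deriv: "\<And>z. (inv F has_derivative DF' z) (at z)"
  shows "\<exists>S1 S2. generated_map F (inv F) DF DF' S S1 S2"
proof -
  obtain S' :: "'n plane \<Rightarrow> 'n plane \<Rightarrow>\<^sub>L real" and S'' :: "'n plane \<Rightarrow> 'n plane \<Rightarrow>\<^sub>L 'n plane \<Rightarrow>\<^sub>L real"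
    where S': "\<And>x. (S has_derivative S' x) (at x)" and S'': "\<And>x. (S' has_derivative S'' x) (at x)"
      and cont: "continuous_on UNIV S''"
    using assms(1) unfolding generating_function_def C2_map_def C1_map_def by blast
  have gen: "F (q, p) = (Q, P) \<longleftrightarrow> p = - grad_q S q Q \<and> P = grad_Q S q Q" for q p Q P
    using assms(1) unfolding generating_function_def by blast
  have deriv1: "((\<lambda>x. S' x b) has_derivative (\<lambda>a. S'' x a b)) (at x)" for x b
    by (rule bounded_linear.has_derivative[OF blinfun.bounded_linear_left S''])
  have linS': "linear (S' x)" for x by (rule bounded_linear.linear) (rule blinfun.bounded_linear_right)
  have grad_q: "grad_q S q Q \<bullet> v = S' (q, Q) (v, 0)" for q Q v
  proof -
    have "((\<lambda>q'. (q', Q)) has_derivative (\<lambda>h. (h, 0))) (at q)" by (auto intro!: derivative_eq_intros)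
    from diff_chain_at[OF this S'] have "((\<lambda>q'. S (q', Q)) has_derivative (\<lambda>h. S' (q, Q) (h, 0))) (at q)"
      by (simp add: o_def)
    note D = this
    have "linear (\<lambda>h. S' (q, Q) (h, 0))" using D by (rule has_derivative_linear)
    from linear_functional_axis[OF this, of v] show ?thesis
      unfolding grad_q_def frechet_derivative_at[OF D, symmetric] .
  qed
  have grad_Q: "grad_Q S q Q \<bullet> v = S' (q, Q) (0, v)" for q Q v
  proof -
    have "((\<lambda>Q'. (q, Q')) has_derivative (\<lambda>h. (0, h))) (at Q)" by (auto intro!: derivative_eq_intros)
    from diff_chain_at[OF this S'] have "((\<lambda>Q'. S (q, Q')) has_derivative (\<lambda>h. S' (q, Q) (0, h))) (at Q)"
      by (simp add: o_def)
    note D = this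
    have "linear (\<lambda>h. S' (q, Q) (0, h))" using D by (rule has_derivative_linear)
    from linear_functional_axis[OF this, of v] show ?thesis
      unfolding grad_Q_def frechet_derivative_at[OF D, symmetric] .
  qed
  have S'_grad: "S' (q, Q) w = grad_q S q Q \<bullet> fst w + grad_Q S q Q \<bullet> snd w" for q Q w
    using linear_add[OF linS', of "(q, Q)" "(fst w, 0)" "(0, snd w)"] by (simp add: grad_q grad_Q)
  have "generated_map F (inv F) DF DF' S (\<lambda>x. blinfun_apply (S' x)) (\<lambda>x a. blinfun_apply (S'' x a))"
  proof
    show "inv F (F z) = z" "F (inv F z) = z" for z
      using F by (simp_all add: bij_is_inj bij_is_surj surj_f_inv_f)
    show "continuous_on UNIV (\<lambda>(x, a, b). S'' x a b)"
    proof -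
      have "continuous_on UNIV (\<lambda>y :: 'n plane \<times> 'n plane \<times> 'n plane. S'' (fst y))"
        by (rule continuous_on_compose2[OF cont]) (auto intro: continuous_on_fst)
      moreover have "continuous_on UNIV (\<lambda>y :: 'n plane \<times> 'n plane \<times> 'n plane. fst (snd y))"
        "continuous_on UNIV (\<lambda>y :: 'n plane \<times> 'n plane \<times> 'n plane. snd (snd y))"
        by (intro continuous_intros)+
      ultimately show ?thesis
        unfolding case_prod_unfold by (intro bounded_bilinear.continuous_on[OF bounded_bilinear_blinfun_apply])
    qed
    show "F (q, p) = (Q, P) \<longleftrightarrow> (\<forall>w. S' (q, Q) w = P \<bullet> snd w - p \<bullet> fst w)" for q p Q P
    proof
      assume "F (q, p) = (Q, P)"
      then show "\<forall>w. S' (q, Q) w = P \<bullet> snd w - p \<bullet> fst w" by (simp add: gen S'_grad)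
    next
      assume *: "\<forall>w. S' (q, Q) w = P \<bullet> snd w - p \<bullet> fst w"
      have "grad_q S q Q \<bullet> v = (- p) \<bullet> v" for v using *[rule_format, of "(v, 0)"] by (simp add: grad_q)
      then have "grad_q S q Q = - p" using vector_eq_rdot by blast
      moreover have "grad_Q S q Q \<bullet> v = P \<bullet> v" for v using *[rule_format, of "(0, v)"] by (simp add: grad_Q)
      then have "grad_Q S q Q = P" using vector_eq_rdot by blast
      ultimately show "F (q, p) = (Q, P)" by (simp add: gen)
    qed
    show "\<exists>p P. F (q, p) = (Q, P)" for q Q by (simp add: gen)
  qed (rule F_deriv F'_deriv S' deriv1)+
  then show ?thesis by blast
qed

text \<open>
  Translating \<open>(q, Q)\<close> by \<open>(k, j)\<close> leaves the momenta unchanged, so both functions have the same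
  derivative.
\<close>

lemma (in generated_map) S_translation:
  assumes F: "\<And>z. F (z + (k, 0)) = F z + (j, 0)"
  shows "\<exists>a. \<forall>x. S (x + (k, j)) = S x + a"
proof -
  have S1_eq: "S1 (x + (k, j)) = S1 x" for x
  proof -
    obtain z where z: "step z = x" using step_surj by blast
    then have "step (z + (k, 0)) = x + (k, j)" by (auto simp: step_def F)
    then show ?thesis using S1_step[of z] S1_step[of "z + (k, 0)"] z F[of z] by auto
  qed
  have "((\<lambda>x. S (x + (k, j)) - S x) has_derivative (\<lambda>h. 0)) (at x within UNIV)" for x
  proof -
    have "((\<lambda>x. x + (k, j)) has_derivative (\<lambda>h. h)) (at x)" by (auto intro!: derivative_eq_intros)
    from diff_chain_at[OF this S_deriv] have "((\<lambda>x. S (x + (k, j))) has_derivative S1 x) (at x)"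
      by (simp add: o_def S1_eq)
    from has_derivative_diff[OF this S_deriv] show ?thesis by simp
  qed
  then obtain a where a: "\<And>x. S (x + (k, j)) - S x = a"
    using has_derivative_zero_constant[OF convex_UNIV, of "\<lambda>x. S (x + (k, j)) - S x"] by blast
  have "S (x + (k, j)) = S x + a" for x using a[of x] by simp
  then show ?thesis by blast
qed

text \<open>
  If \<open>S\<close> decreased under the translation, the infimum that defines the periodic function \<open>u\<close> would
  have to decrease, too. Applied to a translation and its inverse, this shows that \<open>S\<close> is invariant.
\<close>

lemma translation_constant_nonneg:
  fixes S :: "'n::finite plane \<Rightarrow> real"
  assumes S: "\<And>x. S (x + (k, j)) = S x + a" and kj: "k \<in> int_vecs" "j \<in> int_vecs"
    and per: "int_periodic u" and sub: "\<And>x y. u y \<le> u x + S (x, y) - c"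
    and attained: "\<And>y. u y = (INF x. (u x + S (x, y) - c))"
  shows "0 \<le> a"
proof -
  have "u y - a \<le> u x + S (x, y) - c" for x y
  proof -
    have "u y = u (y + j)" "u (x + k) = u x" using per kj by (simp_all add: int_periodic_def)
    then show ?thesis using sub[of "y + j" "x + k"] S[of "(x, y)"] by simp
  qed
  then have "u 0 - a \<le> (INF x. (u x + S (x, 0) - c))" by (intro cINF_greatest) auto
  also have "\<dots> = u 0" by (rule attained[symmetric])
  finally show ?thesis by simp
qed

text \<open>
  The defect \<open>g\<close> of calibration is nonnegative, and it descends to the annulus because \<open>S\<close> is
  invariant under the translations induced by the deck group. Its sum along a segment of an orbit is
  the action of the segment up to the oscillation of \<open>u\<close>. The action is bounded by strong
  minimality, so \<open>g\<close> vanishes on the support by invariance of the measure.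
\<close>

lemma (in generated_map) calibrated_on_support:
  fixes f :: "'n annulus \<Rightarrow> 'n annulus" and c :: real and \<mu> :: "'n annulus measure"
  assumes lift: "C1_lift f F" and cont: "continuous_on UNIV f"
    and crit: "critical_constant S c" and \<mu>: "strongly_minimizing_measure f F S c \<mu>"
  shows "\<exists>u. (\<forall>x y. u y \<le> u x + S (x, y) - c) \<and>
    (\<forall>z. cover z \<in> support \<mu> \<longrightarrow> u (fst (F z)) = u (fst z) + S (fst z, fst (F z)) - c)"
proof -
  obtain u where u: "continuous_on UNIV u" "int_periodic u"
    and u_inf: "\<forall>y. bdd_below (range (\<lambda>x. u x + S (x, y) - c)) \<and> u y = (INF x. (u x + S (x, y) - c))"
    using crit unfolding critical_constant_def by (elim exE conjE) (rule that)
  have attained: "u y = (INF x. (u x + S (x, y) - c))" for y using u_inf by (rule allE[of _ y]) (erule conjunct2)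
  have sub: "u y \<le> u x + S (x, y) - c" for x y
  proof -
    have "bdd_below (range (\<lambda>x. u x + S (x, y) - c))" using u_inf by (rule allE[of _ y]) (erule conjunct1)
    from cINF_lower[OF this, of x] show ?thesis using attained[of y] by simp
  qed
  have S_inv: "S (x + (k, j)) = S x"
    if F: "\<And>z. F (z + (k, 0)) = F z + (j, 0)" and kj: "k \<in> int_vecs" "j \<in> int_vecs" for k j x
  proof -
    obtain a where a: "\<And>x. S (x + (k, j)) = S x + a" using S_translation[OF F] by blast
    have "0 \<le> a" by (rule translation_constant_nonneg[OF a kj u(2) sub attained])
    moreover have "0 \<le> - a"
    proof (rule translation_constant_nonneg[OF _ _ _ u(2) sub attained])
      show "S (x + (- k, - j)) = S x + - a" for x
      proof -
        have eq: "x + (- k, - j) + (k, j) = x" by (simp add: prod_eq_iff)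
        show ?thesis using a[of "x + (- k, - j)"] unfolding eq by linarith
      qed
    qed (use kj int_vecs_minus in auto)
    ultimately show ?thesis using a by simp
  qed
  define g where "g z = u (fst z) + S (step z) - c - u (fst (F z))" for z
  have g0: "0 \<le> g z" for z using sub[of "fst (F z)" "fst z"] by (simp add: g_def step_def)
  have contF: "continuous_on UNIV F"
    using F_deriv by (intro continuous_at_imp_continuous_on ballI has_derivative_continuous) blast
  have contS: "continuous_on UNIV S"
    using S_deriv by (intro continuous_at_imp_continuous_on ballI has_derivative_continuous) blast
  have contg: "continuous_on UNIV g"
  proof -
    have "continuous_on UNIV (\<lambda>z :: 'n plane. u (fst z))" "continuous_on UNIV (\<lambda>z. u (fst (F z)))"
      by (rule continuous_on_compose2[OF u(1)]; intro continuous_on_fst continuous_on_id contF subset_UNIV)+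
    moreover have "continuous_on UNIV (\<lambda>z. S (step z))"
      unfolding step_def
      by (rule continuous_on_compose2[OF contS]; intro continuous_on_Pair continuous_on_fst continuous_on_id contF subset_UNIV)
    ultimately show ?thesis unfolding g_def[abs_def] by (intro continuous_on_add continuous_on_diff continuous_on_const)
  qed
  have per: "g z = g z'" if "cover z = cover z'" for z z'
  proof -
    define k where "k = fst z - fst z'"
    have k: "k \<in> int_vecs" "z = z' + (k, 0)" using that[unfolded cover_eq_iff] by (simp_all add: k_def prod_eq_iff)
    obtain j where j: "j \<in> int_vecs" "\<And>z. F (z + (k, 0)) = F z + (j, 0)"
      using lift_translation[OF lift k(1)] by blast
    have "step z = step z' + (k, j)" using j(2)[of z'] k(2) by (simp add: step_def)
    then show ?thesis
      using S_inv[OF j(2) k(1) j(1), of "step z'"] j(2)[of z'] k u(2) j(1) by (simp add: g_def int_periodic_def)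
  qed
  define g' where "g' x = g (SOME z. cover z = x)" for x
  have g': "g' (cover z) = g z" for z
    unfolding g'_def by (rule per) (rule someI[of "\<lambda>y. cover y = cover z" z], rule refl)
  have cover_F: "cover (F z) = f (cover z)" for z using lift unfolding C1_lift_def by blast
  have iter: "(f ^^ i) (cover z) = cover ((F ^^ i) z)" for i z
    by (induction i) (simp_all add: cover_F)
  have sum: "(\<Sum>i<n. g ((F ^^ i) z)) = action S c (\<lambda>k. fst (int_iter F k z)) 0 (int n) + u (fst z) - u (fst ((F ^^ n) z))"
    for n z
  proof (induction n)
    case 0
    then show ?case by (simp add: action_def)
  next
    case (Suc n)
    have ii: "int_iter F (int m) z = (F ^^ m) z" for m by (simp add: int_iter_def)
    show ?case unfolding action_Suc sum.lessThan_Suc Suc ii by (simp add: g_def step_def)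
  qed
  obtain B where B: "\<And>x. \<bar>u x\<bar> \<le> B" using periodic_bounded[OF u(1,2)] by blast
  obtain K where K: "\<And>x n. strongly_minimizing S c x \<Longrightarrow> n > 0 \<Longrightarrow> action S c x 0 (int n) \<le> K"
    using strongly_minimizing_action_bound[OF contS] by blast
  have zero: "g' x = 0" if "x \<in> support \<mu>" for x
  proof (rule bounded_sums_zero_on_support[OF _ _ _ cont _ _ _ that])
    show "sets \<mu> = sets borel" "distr \<mu> borel f = \<mu>" "prob_space \<mu>"
      using \<mu> by (simp_all add: strongly_minimizing_measure_def)
    show "continuous_on UNIV g'" by (rule continuous_on_annulus) (use contg g' in simp)
    show "0 \<le> g' x" for x unfolding g'_def by (rule g0)
    show "(\<Sum>i<n. g' ((f ^^ i) x)) \<le> \<bar>K\<bar> + 2 * B" if x: "x \<in> support \<mu>" for x n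
    proof (cases "n = 0")
      case True
      then show ?thesis using B[of 0] by simp
    next
      case False
      obtain z where z: "cover z = x" using surj_cover by blast
      then have "cover z \<in> support \<mu>" using x by simp
      then have "strongly_minimizing S c (\<lambda>k. fst (int_iter F k z))"
        using \<mu> unfolding strongly_minimizing_measure_def by blast
      from K[OF this, of n] have "action S c (\<lambda>k. fst (int_iter F k z)) 0 (int n) \<le> K" using False by simp
      moreover have "(\<Sum>i<n. g' ((f ^^ i) x)) = (\<Sum>i<n. g ((F ^^ i) z))"
        by (simp add: z[symmetric] iter g')
      ultimately show ?thesis using sum[of z n] B[of "fst z"] B[of "fst ((F ^^ n) z)"] by linarith
    qed
  qed
  have "u (fst (F z)) = u (fst z) + S (fst z, fst (F z)) - c" if "cover z \<in> support \<mu>" for z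
    using zero[OF that] by (simp add: g' g_def step_def)
  then show ?thesis using sub by blast
qed

section \<open>The limit contingent cone and the modified Green bundles\<close>

lemma (in calibrated) subspace_backward_green: "subspace (backward_green k z)"
proof -
  obtain D where D: "(F' ^^ k has_derivative D) (at ((F ^^ k) z))"
    using funpow_has_derivative[OF F'_deriv] by blast
  show ?thesis
    unfolding backward_green_def frechet_derivative_at[OF D, symmetric]
    by (rule linear_subspace_image[OF has_derivative_linear[OF D] subspace_vertical])
qed

lemma slope_unique: "(THE A. matrix_graph B = matrix_graph A) = (B :: real ^ 'n::finite ^ 'n)"
  by (simp add: matrix_graph_inject)

theorem theorem3:
  fixes f :: "'n::finite annulus \<Rightarrow> 'n annulus"
    and F :: "'n plane \<Rightarrow> 'n plane"
    and S :: "'n plane \<Rightarrow> real"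
    and Lbar :: real
    and \<mu> :: "'n annulus measure"
    and x :: "'n annulus"
    and z :: "'n plane"
  assumes "globally_positive f F S"
    and "critical_constant S Lbar"
    and "strongly_minimizing_measure f F S Lbar \<mu>"
    and "x \<in> support \<mu>"
    and "cover z = x"
  shows "set_between (modified_green_minus F z)
           (limit_contingent_cone (cover -` support \<mu>) z)
           (modified_green_plus F z)"
proof -
  obtain G where f: "bij f" and lift: "C1_lift f F" and G: "C1_lift (inv f) G"
    and sym: "symplectic_map F" and gen: "generating_function F S"
    using assms(1) unfolding globally_positive_def C1_diffeo_def by blast
  have bij: "bij F" by (rule lift_bijective(1)[OF f lift G])
  obtain DF' where DF': "\<And>z. (inv F has_derivative DF' z) (at z)"
    using lift_bijective(2)[OF f lift G] by blast
  define DF where "DF z = frechet_derivative F (at z)" for z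
  have DF: "(F has_derivative DF z) (at z)" for z
  proof -
    obtain D where "\<And>x. (F has_derivative D x) (at x)"
      using lift C1_map_differentiable unfolding C1_lift_def by blast
    then show ?thesis unfolding DF_def using frechet_derivative_at[of F "D z"] by metis
  qed
  obtain S1 S2 where gm: "generated_map F (inv F) DF DF' S S1 S2"
    using generating_function_derivatives[OF gen bij DF DF'] by blast
  interpret gm: generated_map F "inv F" DF DF' S S1 S2 by (rule gm)
  have contF: "continuous_on UNIV F" and contG: "continuous_on UNIV G"
    using lift G C1_map_continuous by (auto simp: C1_lift_def)
  have cover_F: "cover (F z) = f (cover z)" and cover_G: "cover (G z) = inv f (cover z)" for z
    using lift G unfolding C1_lift_def by blast+
  have contf: "continuous_on UNIV f"
  proof (rule continuous_on_annulus)
    have "continuous_on UNIV (\<lambda>z. cover (F z))"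
      by (rule continuous_on_compose2[OF continuous_cover contF]) auto
    then show "continuous_on UNIV (\<lambda>z. f (cover z))" unfolding cover_F .
  qed
  have contf': "continuous_on UNIV (inv f)"
  proof (rule continuous_on_annulus)
    have "continuous_on UNIV (\<lambda>z. cover (G z))"
      by (rule continuous_on_compose2[OF continuous_cover contG]) auto
    then show "continuous_on UNIV (\<lambda>z. inv f (cover z))" unfolding cover_G .
  qed
  define M where "M = cover -` support \<mu>"
  obtain u where u: "\<forall>x y. u y \<le> u x + S (x, y) - Lbar"
    "\<forall>z. cover z \<in> support \<mu> \<longrightarrow> u (fst (F z)) = u (fst z) + S (fst z, fst (F z)) - Lbar"
    using gm.calibrated_on_support[OF lift contf assms(2,3)] by (elim exE conjE)
  interpret calibrated F "inv F" DF DF' S S1 S2 M u Lbar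
  proof
    have "omega (DF z v) (DF z w) = omega v w" for z v w
      using sym unfolding symplectic_map_def DF_def by blast
    then show "S2 x a b = S2 x b a" for x a b by (rule gm.S2_sym_if_symplectic)
    have "f x \<in> support \<mu> \<longleftrightarrow> x \<in> support \<mu>" for x
      using assms(3) by (intro support_invariant f contf contf') (simp_all add: strongly_minimizing_measure_def)
    then show "F z \<in> M \<longleftrightarrow> z \<in> M" for z by (simp add: M_def cover_F)
    show "u y \<le> u y' + S (y', y) - Lbar" for y y' using u(1) by blast
    show "u (fst (F z)) = u (fst z) + S (fst z, fst (F z)) - Lbar" if "z \<in> M" for z
      using u(2) that unfolding M_def vimage_def by blast
  qed
  have zM: "z \<in> M" using assms(4,5) by (simp add: M_def)
  obtain P P\<^sub>0 N N\<^sub>0 where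
    P_graph: "\<forall>k. gm.green (Suc k) z = matrix_graph (P k)" and P: "P \<longlonglongrightarrow> P\<^sub>0" "transpose P\<^sub>0 = P\<^sub>0"
    and N_graph: "\<forall>k. backward_green (Suc k) z = matrix_graph (N k)" and N: "N \<longlonglongrightarrow> N\<^sub>0" "transpose N\<^sub>0 = N\<^sub>0"
    and pair: "\<forall>v w \<eta>. (v, w) \<in> paratingent_cone M z \<longrightarrow>
      - (w \<bullet> (2 *\<^sub>R \<eta> + v)) \<le> \<eta> \<bullet> (P\<^sub>0 *v \<eta>) - (\<eta> + v) \<bullet> (N\<^sub>0 *v (\<eta> + v))"
    by (rule green_bundles[OF zM])
  have "green_iterate F (int k) z = gm.green k z" "green_iterate F (- int k) z = backward_green k z" for k
    by (cases "k = 0"; simp add: green_iterate_def gm.green_def backward_green_def int_iter_def)+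
  then have gp: "green_plus F z = matrix_graph P\<^sub>0" and gn: "green_minus F z = matrix_graph N\<^sub>0"
    unfolding green_plus_def green_minus_def
    using the_subspace_limit_matrix_graph[OF gm.subspace_green P_graph[rule_format] P(1)]
      the_subspace_limit_matrix_graph[OF subspace_backward_green N_graph[rule_format] N(1)] by simp_all
  have mp: "modified_green_plus F z = matrix_graph (P\<^sub>0 + c0 *\<^sub>R (P\<^sub>0 - N\<^sub>0))"
    and mn: "modified_green_minus F z = matrix_graph (N\<^sub>0 - c0 *\<^sub>R (P\<^sub>0 - N\<^sub>0))"
    by (simp_all add: modified_green_plus_def modified_green_minus_def slope_plus_def slope_minus_def gp gn slope_unique)
  have le: "h \<bullet> (N\<^sub>0 *v h) \<le> h \<bullet> (P\<^sub>0 *v h)" for h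
    using pair[rule_format, of 0 0 h] zero_in_paratingent_cone[OF zM] by (simp add: zero_prod_def)
  have between: "vector_between (modified_green_minus F z) y (modified_green_plus F z)"
    if "y \<in> limit_contingent_cone M z" for y
  proof -
    have "(fst y, snd y) \<in> paratingent_cone M z"
      using limit_contingent_cone_paratingent[OF that zM] by simp
    from between_modified[OF P(2) N(2) le pair[rule_format, OF this]] show ?thesis by (simp add: mp mn)
  qed
  have "lag_le (modified_green_minus F z) (modified_green_plus F z)"
    unfolding mp mn
  proof (rule lag_le_matrix_graph)
    show "transpose (N\<^sub>0 - c0 *\<^sub>R (P\<^sub>0 - N\<^sub>0)) = N\<^sub>0 - c0 *\<^sub>R (P\<^sub>0 - N\<^sub>0)"
      "transpose (P\<^sub>0 + c0 *\<^sub>R (P\<^sub>0 - N\<^sub>0)) = P\<^sub>0 + c0 *\<^sub>R (P\<^sub>0 - N\<^sub>0)"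
      using P(2) N(2) by (simp_all add: transpose_def vec_eq_iff)
    fix h
    have "0 \<le> (1 + 2 * c0) * (h \<bullet> (P\<^sub>0 *v h) - h \<bullet> (N\<^sub>0 *v h))"
      using le[of h] c0_nonneg by (intro mult_nonneg_nonneg) auto
    then show "h \<bullet> ((N\<^sub>0 - c0 *\<^sub>R (P\<^sub>0 - N\<^sub>0)) *v h) \<le> h \<bullet> ((P\<^sub>0 + c0 *\<^sub>R (P\<^sub>0 - N\<^sub>0)) *v h)"
      by (simp add: matrix_vector_mult_add_rdistrib matrix_vector_mult_diff_rdistrib scaleR_matrix_vector_assoc[symmetric]
          inner_add_right inner_diff_right algebra_simps)
  qed
  with between show ?thesis unfolding set_between_def M_def by blast
qed

end
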